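(* Let $d\in\{1,2,3\}$, let $\Omega\subset\mathbb{R}^d$ be a bounded domain with (strong) Lipschitz boundary, $T>0$, $I=(0,T)$, $\mu_0,m_0>0$ constants, and $0<\beta<\infty$. Let $h\in (H^s(I))^d$ with $s\ge 1$, $g\in (L^\infty(\Omega))^d$ and $p\in (L^\infty(\Omega))^d$. Let $H(x,t)=g(x)-h(t)$ and $$\kappa(x,t)=\mu_0m_0\,p(x)^t\frac{\mathrm{d}}{\mathrm{d}t}\left[\frac{\mathcal{L}_\beta(|H(x,t)|)}{|H(x,t)|}H(x,t)\right],$$ and let $F:L^2(\Omega)\to L^2(I)$ be the integral operator $(Fc)(t)=\int_\Omega c(x)\kappa(x,t)\,\mathrm{d}x$. Then the singular values $\sigma_n$ of $F$ (ordered nonincreasingly) satisfy $\sigma_n\le C n^{\frac12-s}$ for all $n\ge1$, with a constant $C$ independent of $n$.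
   Context: The superscript $t$ on a vector denotes transpose and $|\cdot|$ is the Euclidean norm. The (scaled) Langevin function is $\mathcal{L}_\beta(z)=\coth(\beta z)-(\beta z)^{-1}$ (with $\mathcal{L}_\beta(0)=0$ by continuity), and $\mathcal{L}_\beta(|H|)/|H|$ is understood by its continuous extension where $H=0$. $H^s(I)$ is the $L^2$-based Sobolev space (Sobolev--Slobodeckij for non-integer $s$). *)

theory Defs
  imports "HOL-Analysis.Analysis" "HOL-Real_Asymp.Real_Asymp"
begin

section \<open>Domains\<close>

text \<open>
  A bounded domain with (strong) Lipschitz boundary: near every boundary point, \<open>\<Omega>\<close> is, in
  suitable Cartesian coordinates, the set strictly above the graph of a Lipschitz function of
  the other coordinates.  The last coordinate direction is the unit vector \<open>\<nu>\<close>; the space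
  of the other coordinates is the hyperplane orthogonal to \<open>\<nu>\<close>, so that \<open>\<gamma>\<close> is only
  relevant there.  In dimension one the hyperplane is a point and \<open>\<gamma>\<close> a constant.
\<close>

definition lipschitz_boundary :: "'a::euclidean_space set \<Rightarrow> bool" where
  "lipschitz_boundary \<Omega> \<longleftrightarrow>
     (\<forall>x0 \<in> frontier \<Omega>. \<exists>r > 0. \<exists>\<nu> L. \<exists>\<gamma> :: 'a \<Rightarrow> real.
        norm \<nu> = 1 \<and> L-lipschitz_on {y. y \<bullet> \<nu> = 0} \<gamma> \<and>
        \<Omega> \<inter> ball x0 r = {x \<in> ball x0 r. x \<bullet> \<nu> > \<gamma> (x - (x \<bullet> \<nu>) *\<^sub>R \<nu>)})"

definition bounded_lipschitz_domain :: "'a::euclidean_space set \<Rightarrow> bool" where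
  "bounded_lipschitz_domain \<Omega> \<longleftrightarrow>
     open \<Omega> \<and> connected \<Omega> \<and> \<Omega> \<noteq> {} \<and> bounded \<Omega> \<and> lipschitz_boundary \<Omega>"


section \<open>Function spaces\<close>

text \<open>
  Elements of the spaces below are represented by functions; two functions that agree almost
  everywhere represent the same element.
\<close>

definition l2 :: "'a measure \<Rightarrow> ('a \<Rightarrow> real) set" where
  "l2 M = {f \<in> borel_measurable M. integrable M (\<lambda>x. (f x)\<^sup>2)}"

definition l2_inner :: "'a measure \<Rightarrow> ('a \<Rightarrow> real) \<Rightarrow> ('a \<Rightarrow> real) \<Rightarrow> real" where
  "l2_inner M f g = (LINT x|M. f x * g x)"

definition linf :: "'a measure \<Rightarrow> ('a \<Rightarrow> real) set" where
  "linf M = {f \<in> borel_measurable M. \<exists>B. AE x in M. \<bar>f x\<bar> \<le> B}"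

definition test_functions :: "real set \<Rightarrow> (real \<Rightarrow> real) set" where
  "test_functions I =
     {\<phi>. (\<forall>k x. (deriv ^^ k) \<phi> field_differentiable at x) \<and>
          (\<exists>K. compact K \<and> K \<subseteq> I \<and> (\<forall>x. x \<notin> K \<longrightarrow> \<phi> x = 0))}"

definition has_weak_deriv :: "real set \<Rightarrow> nat \<Rightarrow> (real \<Rightarrow> real) \<Rightarrow> (real \<Rightarrow> real) \<Rightarrow> bool" where
  "has_weak_deriv I k f v \<longleftrightarrow>
     (\<forall>\<phi> \<in> test_functions I.
        (LINT x|lebesgue_on I. f x * (deriv ^^ k) \<phi> x) =
        (-1) ^ k * (LINT x|lebesgue_on I. v x * \<phi> x))"

definition slobodeckij_energy :: "real set \<Rightarrow> real \<Rightarrow> (real \<Rightarrow> real) \<Rightarrow> ennreal" where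
  "slobodeckij_energy I \<theta> f =
     (\<integral>\<^sup>+ (x, y). ennreal ((f x - f y)\<^sup>2 / \<bar>x - y\<bar> powr (1 + 2 * \<theta>))
        \<partial>(lebesgue_on I \<Otimes>\<^sub>M lebesgue_on I))"

text \<open>
  The Sobolev(-Slobodeckij) space \<open>H\<^sup>s(I)\<close> for real \<open>s \<ge> 0\<close>.  The function
  \<open>v k\<close> is the weak derivative of order \<open>k\<close>.
\<close>

definition sobolev :: "real \<Rightarrow> real set \<Rightarrow> (real \<Rightarrow> real) set" where
  "sobolev s I =
     {f \<in> l2 (lebesgue_on I). \<exists>v :: nat \<Rightarrow> real \<Rightarrow> real.
        (\<forall>k \<le> nat \<lfloor>s\<rfloor>. v k \<in> l2 (lebesgue_on I) \<and> has_weak_deriv I k f (v k)) \<and>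
        (s \<notin> \<int> \<longrightarrow> slobodeckij_energy I (frac s) (v (nat \<lfloor>s\<rfloor>)) < \<infinity>)}"

text \<open>
  On an open interval, an element of \<open>H\<^sup>s\<close> with \<open>s \<ge> 1\<close> has exactly one continuous
  representative.  It is locally absolutely continuous, and its pointwise derivative, which
  exists almost everywhere, is its weak derivative.  The values of \<open>cont_rep I h\<close> off
  \<open>I\<close> are arbitrary.
\<close>

definition cont_rep :: "real set \<Rightarrow> (real \<Rightarrow> 'a::euclidean_space) \<Rightarrow> real \<Rightarrow> 'a" where
  "cont_rep I h = (SOME u. continuous_on I u \<and> (AE t in lebesgue_on I. u t = h t))"


section \<open>The Langevin function and the integral operator\<close>

definition langevin :: "real \<Rightarrow> real \<Rightarrow> real" where
  "langevin \<beta> z = (if z = 0 then 0 else cosh (\<beta> * z) / sinh (\<beta> * z) - 1 / (\<beta> * z))"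

text \<open>The continuous extension of \<open>z \<mapsto> \<L>\<^sub>\<beta>(z) / z\<close>; its value at the origin is justified below.\<close>

definition langevin_quotient :: "real \<Rightarrow> real \<Rightarrow> real" where
  "langevin_quotient \<beta> z = (if z = 0 then \<beta> / 3 else langevin \<beta> z / z)"

lemma isCont_langevin_0:
  assumes "\<beta> > 0"
  shows "isCont (langevin \<beta>) 0"
proof -
  have "((\<lambda>z. cosh (\<beta> * z) / sinh (\<beta> * z) - 1 / (\<beta> * z)) \<longlongrightarrow> 0) (at 0)"
    using assms by real_asymp
  then have "(langevin \<beta> \<longlongrightarrow> 0) (at 0)"
    by (rule Lim_transform_eventually) (auto simp: langevin_def eventually_at_filter)
  then show ?thesis by (simp add: isCont_def langevin_def)
qed

lemma isCont_langevin_quotient_0: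
  assumes "\<beta> > 0"
  shows "isCont (langevin_quotient \<beta>) 0"
proof -
  have "((\<lambda>z. (cosh (\<beta> * z) / sinh (\<beta> * z) - 1 / (\<beta> * z)) / z) \<longlongrightarrow> \<beta> / 3) (at 0)"
    using assms by (real_asymp simp: field_simps)
  then have "(langevin_quotient \<beta> \<longlongrightarrow> \<beta> / 3) (at 0)"
    by (rule Lim_transform_eventually)
       (auto simp: langevin_def langevin_quotient_def eventually_at_filter)
  then show ?thesis by (simp add: isCont_def langevin_quotient_def)
qed

definition field_H ::
  "real \<Rightarrow> (real ^ 'd \<Rightarrow> real ^ 'd) \<Rightarrow> (real \<Rightarrow> real ^ 'd) \<Rightarrow> real ^ 'd \<Rightarrow> real \<Rightarrow> real ^ 'd" where
  "field_H T g h x t = g x - cont_rep {0<..<T} h t"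

definition kernel ::
  "real \<Rightarrow> real \<Rightarrow> real \<Rightarrow> real \<Rightarrow> (real ^ 'd \<Rightarrow> real ^ 'd) \<Rightarrow> (real \<Rightarrow> real ^ 'd) \<Rightarrow>
   (real ^ 'd \<Rightarrow> real ^ 'd) \<Rightarrow> real ^ 'd \<Rightarrow> real \<Rightarrow> real" where
  "kernel \<mu>0 m0 \<beta> T g h p x t =
     \<mu>0 * m0 * (p x \<bullet> vector_derivative
       (\<lambda>\<tau>. langevin_quotient \<beta> (norm (field_H T g h x \<tau>)) *\<^sub>R field_H T g h x \<tau>) (at t))"

definition integral_operator ::
  "'a measure \<Rightarrow> ('a \<Rightarrow> 'b \<Rightarrow> real) \<Rightarrow> ('a \<Rightarrow> real) \<Rightarrow> 'b \<Rightarrow> real" where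
  "integral_operator M \<kappa> c = (\<lambda>t. LINT x|M. c x * \<kappa> x t)"


section \<open>Singular values\<close>

text \<open>
  In this section \<open>F\<close> is a compact linear operator from \<open>L\<^sup>2(M)\<close> to \<open>L\<^sup>2(N)\<close>.
\<close>

definition l2_adjoint ::
  "'a measure \<Rightarrow> 'b measure \<Rightarrow> (('a \<Rightarrow> real) \<Rightarrow> 'b \<Rightarrow> real) \<Rightarrow> ('b \<Rightarrow> real) \<Rightarrow> 'a \<Rightarrow> real" where
  "l2_adjoint M N F v =
     (SOME w. w \<in> l2 M \<and> (\<forall>c \<in> l2 M. l2_inner N (F c) v = l2_inner M c w))"

text \<open>
  \<open>F\<close> has at least \<open>n\<close> singular values that are \<open>\<ge> \<sigma>\<close>, counted with multiplicity.
  Singular values are the square roots of the eigenvalues of \<open>F\<^sup>* F\<close>, and the multiplicity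
  of an eigenvalue is the dimension of its eigenspace.  Eigenspaces for different eigenvalues
  are orthogonal, so the multiplicities of the eigenvalues \<open>\<ge> \<sigma>\<^sup>2\<close> add up to at least
  \<open>n\<close> iff there are \<open>n\<close> orthonormal eigenfunctions for such eigenvalues.
\<close>

definition n_singular_values_ge ::
  "'a measure \<Rightarrow> 'b measure \<Rightarrow> (('a \<Rightarrow> real) \<Rightarrow> 'b \<Rightarrow> real) \<Rightarrow> nat \<Rightarrow> real \<Rightarrow> bool" where
  "n_singular_values_ge M N F n \<sigma> \<longleftrightarrow>
     (\<exists>(e :: nat \<Rightarrow> 'a \<Rightarrow> real) (ev :: nat \<Rightarrow> real).
        (\<forall>i<n. e i \<in> l2 M) \<and>
        (\<forall>i<n. \<forall>j<n. l2_inner M (e i) (e j) = (if i = j then 1 else 0)) \<and>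
        (\<forall>i<n. (AE x in M. l2_adjoint M N F (F (e i)) x = ev i * e i x) \<and> \<sigma> \<le> sqrt (ev i)))"

text \<open>
  The \<open>n\<close>-th entry (\<open>n \<ge> 1\<close>) of the nonincreasing list of singular values, repeated
  according to multiplicity and continued by \<open>0\<close> if there are only finitely many.
\<close>

definition singular_value ::
  "'a measure \<Rightarrow> 'b measure \<Rightarrow> (('a \<Rightarrow> real) \<Rightarrow> 'b \<Rightarrow> real) \<Rightarrow> nat \<Rightarrow> real" where
  "singular_value M N F n = Sup (insert 0 {\<sigma>. 0 \<le> \<sigma> \<and> n_singular_values_ge M N F n \<sigma>})"

end

theory Submission
  imports Defs
begin

text \<open>
  With \<open>\<L>\<^sub>\<beta>(z) / z = \<phi>(z\<^sup>2)\<close>, where \<open>\<phi>\<close> is smooth on a neighbourhood of \<open>[0, \<infinity>)\<close>, the kernel is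
  \<open>- \<mu>\<^sub>0 m\<^sub>0 (\<phi>(\<bar>H\<bar>\<^sup>2) p \<bullet> h' + 2 \<phi>'(\<bar>H\<bar>\<^sup>2) (p \<bullet> H) (H \<bullet> h'))\<close>.  For \<open>t\<close> close to a node
  \<open>\<tau>\<close>, Taylor expansion of \<open>\<phi>\<close> and \<open>\<phi>'\<close> at \<open>\<bar>H(x, \<tau>)\<bar>\<^sup>2\<close> separates the variables, because
  \<open>\<bar>H(x, t)\<bar>\<^sup>2 - \<bar>H(x, \<tau>)\<bar>\<^sup>2\<close> is affine in \<open>g(x)\<close>.  The representative of \<open>h\<close> is Hoelder continuous
  of order \<open>1/2\<close>, so with \<open>n\<close> equidistant nodes and order \<open>L\<close> the kernel is approximated up to
  \<open>O(n\<^bsup>-L/2\<^esup>)\<close> by one of rank \<open>O(n)\<close>.  Among more orthonormal eigenfunctions than the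
  rank there is a combination which the approximating operator annihilates, and this bounds the
  corresponding singular value.  Taking \<open>L \<ge> 2 s\<close> gives the rate.
\<close>


section \<open>Smooth bump functions\<close>

text \<open>For fixed t the values of h and h' are mere coefficients, so the approximating functions
  of x depend only on the node. The roughness of h' therefore enters as a square-integrable factor
  in t and never has to be approximated. The accuracy is governed by the increment of
  \<bar>H\<bar>^2 over one cell, at most a multiple of n^(-1/2), whose L-th power is the Taylor
  error. The squared norm is the right variable since \<bar>H\<bar> itself is not differentiable
  where H = 0. The remaining obstacles lie in the representatives. The function h is given through
  weak derivatives, so a Du Bois-Reymond argument, and with it a supply of compactly supported
  smooth functions, has to produce its absolutely continuous version. The functions g and p are
  bounded only almost everywhere, and the adjoint is an unspecified choice whose existence must be
  shown.\<close>

definition smooth_real :: "(real \<Rightarrow> real) \<Rightarrow> bool" where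
  "smooth_real f \<longleftrightarrow> (\<forall>k x. (deriv ^^ k) f field_differentiable at x)"

text \<open>Iterated derivatives never leave a class closed under differentiation. Smoothness proofs
  thus only exhibit such a class and need no formula for the \<open>k\<close>-th derivative.\<close>

lemma smooth_real_coinduct:
  assumes "f \<in> F" and step: "\<And>g. g \<in> F \<Longrightarrow> \<exists>g'\<in>F. \<forall>x. (g has_field_derivative g' x) (at x)"
  shows "smooth_real f"
proof -
  have *: "(deriv ^^ k) f \<in> F" for k
  proof (induction k)
    case (Suc k)
    then obtain g' where g': "g' \<in> F" "\<forall>x. ((deriv ^^ k) f has_field_derivative g' x) (at x)"
      using step by blast
    then have "deriv ((deriv ^^ k) f) = g'"
      by (auto intro!: DERIV_imp_deriv)
    then show ?case using g' by simp
  qed (use assms in simp)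
  show ?thesis
    unfolding smooth_real_def using step[OF *] by (meson field_differentiable_def)
qed

lemma smooth_real_deriv:
  assumes "smooth_real f"
  shows "smooth_real (deriv f)" and "(f has_field_derivative deriv f x) (at x)"
proof -
  show "smooth_real (deriv f)"
    unfolding smooth_real_def using assms[unfolded smooth_real_def]
    by (metis funpow_Suc_right o_apply)
  show "(f has_field_derivative deriv f x) (at x)"
    using assms[unfolded smooth_real_def, rule_format, of 0 x]
    by (simp add: DERIV_deriv_iff_field_differentiable)
qed

lemma smooth_real_continuous_on: "smooth_real f \<Longrightarrow> continuous_on A f"
  using smooth_real_deriv(2) by (meson DERIV_isCont continuous_at_imp_continuous_on)

lemma smooth_real_antiderivative:
  assumes "\<And>x. (G has_field_derivative f x) (at x)" and "smooth_real f"
  shows "smooth_real G"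
  by (rule smooth_real_coinduct[of _ "insert G (Collect smooth_real)"])
     (use assms smooth_real_deriv in blast)+

text \<open>The free factor \<open>c\<close> in the class absorbs the powers of \<open>a\<close>
  that the chain rule produces.\<close>

lemma smooth_real_affine:
  assumes "smooth_real f"
  shows "smooth_real (\<lambda>x. f (a * x + b))"
proof (rule smooth_real_coinduct[of _ "{\<lambda>x. c * g (a * x + b) | c g. smooth_real g}"])
  show "(\<lambda>x. f (a * x + b)) \<in> {\<lambda>x. c * g (a * x + b) | c g. smooth_real g}"
    using assms by (intro CollectI exI[of _ 1] exI[of _ f]) auto
next
  fix g assume "g \<in> {\<lambda>x. c * g (a * x + b) | c g. smooth_real g}"
  then obtain c k where g: "g = (\<lambda>x. c * k (a * x + b))" and k: "smooth_real k"
    by blast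
  have "\<forall>x. (g has_field_derivative (c * a) * deriv k (a * x + b)) (at x)"
    unfolding g
    by (auto intro!: derivative_eq_intros DERIV_chain2[OF smooth_real_deriv(2)[OF k]])
  then show "\<exists>g'\<in>{\<lambda>x. c * g (a * x + b) | c g. smooth_real g}.
               \<forall>x. (g has_field_derivative g' x) (at x)"
    using smooth_real_deriv(1)[OF k]
    by (intro bexI[of _ "\<lambda>x. (c * a) * deriv k (a * x + b)"]) blast+
qed

text \<open>Leibniz' rule turns a product into a sum of two products, so products alone are not
  closed under differentiation, while finite sums of them are.\<close>

inductive_set product_sums :: "(real \<Rightarrow> real) set" where
  prod: "smooth_real f \<Longrightarrow> smooth_real g \<Longrightarrow> (\<lambda>x. f x * g x) \<in> product_sums"
| add: "a \<in> product_sums \<Longrightarrow> b \<in> product_sums \<Longrightarrow> (\<lambda>x. a x + b x) \<in> product_sums"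

lemma product_sums_deriv:
  assumes "a \<in> product_sums"
  shows "\<exists>a'\<in>product_sums. \<forall>x. (a has_field_derivative a' x) (at x)"
  using assms
proof induction
  case (prod f g)
  have "\<forall>x. ((\<lambda>x. f x * g x) has_field_derivative (deriv f x * g x + f x * deriv g x)) (at x)"
    by (auto intro!: derivative_eq_intros smooth_real_deriv(2) prod)
  moreover have "(\<lambda>x. deriv f x * g x + f x * deriv g x) \<in> product_sums"
    by (intro product_sums.intros smooth_real_deriv prod)
  ultimately show ?case by (rule bexI)
next
  case (add a b)
  then obtain a' b' where "a' \<in> product_sums" "b' \<in> product_sums"
    "\<forall>x. (a has_field_derivative a' x) (at x)" "\<forall>x. (b has_field_derivative b' x) (at x)"
    by blast
  then show ?case
    by (intro bexI[of _ "\<lambda>x. a' x + b' x"]) (auto intro!: derivative_eq_intros product_sums.add)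
qed

lemma product_sums_smooth: "a \<in> product_sums \<Longrightarrow> smooth_real a"
  using smooth_real_coinduct product_sums_deriv by blast

lemma smooth_real_const: "smooth_real (\<lambda>x. c)"
proof (rule smooth_real_coinduct[of _ "range (\<lambda>c x. c)"])
  fix g :: "real \<Rightarrow> real" assume "g \<in> range (\<lambda>c x. c)"
  then show "\<exists>g'\<in>range (\<lambda>c x. c). \<forall>x. (g has_field_derivative g' x) (at x)"
    by (intro bexI[of _ "\<lambda>x. 0"]) auto
qed auto

lemma smooth_real_mult:
  "smooth_real f \<Longrightarrow> smooth_real g \<Longrightarrow> smooth_real (\<lambda>x. f x * g x)"
  by (intro product_sums_smooth[of "\<lambda>x. f x * g x"] product_sums.prod)

lemma smooth_real_diff_cmult:
  assumes "smooth_real f" "smooth_real g"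
  shows "smooth_real (\<lambda>x. f x - c * g x)"
proof -
  have "(\<lambda>x. f x * 1 + (- c) * g x) \<in> product_sums"
    by (intro product_sums.intros smooth_real_const assms)
  then show ?thesis using product_sums_smooth by simp
qed

section \<open>The flat function exp(-1/x) and the bumps built from it\<close>

definition exp_cutoff :: "real \<Rightarrow> real" where
  "exp_cutoff x = (if x > 0 then exp (- (1 / x)) else 0)"

lemma poly_times_exp_neg_tendsto_0: "((\<lambda>y. poly p y * exp (- y)) \<longlongrightarrow> (0::real)) at_top"
proof -
  have "((\<lambda>y. coeff p i * y ^ i * exp (- y)) \<longlongrightarrow> (0::real)) at_top" for i
  proof -
    have "((\<lambda>y. coeff p i * (y ^ i / exp y)) \<longlongrightarrow> coeff p i * 0) at_top"
      by (intro tendsto_mult tendsto_const tendsto_power_div_exp_0)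
    then show ?thesis by (simp add: exp_minus field_simps)
  qed
  then have "((\<lambda>y. \<Sum>i\<le>degree p. coeff p i * y ^ i * exp (- y)) \<longlongrightarrow> (\<Sum>i\<le>degree p. 0)) at_top"
    by (intro tendsto_sum)
  then show ?thesis by (simp add: poly_altdef sum_distrib_right)
qed

text \<open>The functions p(1/x) exp(-1/x), extended by zero to x \<le> 0, form a class closed under
  differentiation. Only the origin needs an argument: there the exponential decay beats every power
  of 1/x.\<close>

lemma smooth_exp_cutoff: "smooth_real exp_cutoff"
proof (rule smooth_real_coinduct)
  let ?f = "\<lambda>p x :: real. if x > 0 then poly p (1 / x) * exp (- (1 / x)) else 0"
  show "exp_cutoff \<in> range ?f"
    by (rule image_eqI[of _ _ 1]) (auto simp: exp_cutoff_def fun_eq_iff)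
  fix g assume "g \<in> range ?f"
  then obtain p where g: "g = ?f p" by blast
  \<comment> \<open>With y = 1/x one has dy/dx = - y^2, and p(y) exp(-y) has the y-derivative (p' -
    p)(y) exp(-y). The factor \<open>[:0, 0, 1:]\<close> is y^2.\<close>
  define q where "q = [:0, 0, 1:] * (p - pderiv p)"
  have "(g has_field_derivative ?f q x) (at x)" for x
  proof -
    consider "x > 0" | "x < 0" | "x = 0" by linarith
    then show ?thesis
    proof cases
      case 1
      have "((\<lambda>x. poly p (1 / x) * exp (- (1 / x))) has_field_derivative ?f q x) (at x)"
        using 1
        by (auto intro!: derivative_eq_intros DERIV_chain2[OF poly_DERIV]
                 simp: q_def power2_eq_square field_simps)
      then show ?thesis
        by (rule has_field_derivative_transform_within_open[of _ _ _ "{0<..}"]) (auto simp: g 1)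
    next
      case 2
      have "((\<lambda>x. 0) has_field_derivative ?f q x) (at x)"
        using 2 by simp
      then show ?thesis
        by (rule has_field_derivative_transform_within_open[of _ _ _ "{..<0}"]) (auto simp: g 2)
    next
      case 3
      \<comment> \<open>At y = 1/h the difference quotient \<open>g h / h\<close> is y p(y) exp(-y),
        hence the extra factor \<open>[:0, 1:]\<close>.\<close>
      have "((\<lambda>y. poly ([:0, 1:] * p) y * exp (- y)) \<longlongrightarrow> 0) at_top"
        by (rule poly_times_exp_neg_tendsto_0)
      then have "((\<lambda>h. poly ([:0, 1:] * p) (inverse h) * exp (- inverse h)) \<longlongrightarrow> 0) (at_right 0)"
        by (rule filterlim_compose[OF _ filterlim_inverse_at_top_right])
      then have "((\<lambda>h. g h / h) \<longlongrightarrow> 0) (at_right 0)"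
        by (rule Lim_transform_eventually)
           (auto simp: g eventually_at_filter field_simps)
      moreover have "((\<lambda>h. g h / h) \<longlongrightarrow> 0) (at_left 0)"
        by (rule Lim_transform_eventually[OF tendsto_const])
           (auto simp: g eventually_at_filter)
      ultimately have "((\<lambda>h. g h / h) \<longlongrightarrow> 0) (at 0)"
        by (simp add: filterlim_at_split)
      then show ?thesis
        unfolding DERIV_def 3 by (simp add: g)
    qed
  qed
  then show "\<exists>g'\<in>range ?f. \<forall>x. (g has_field_derivative g' x) (at x)"
    by (intro bexI[of _ "?f q"]) auto
qed

text \<open>The parameter \<open>n\<close> only steepens the flanks: the function vanishes off the
  open interval for every \<open>n\<close>, and inside it tends to 1 as \<open>n\<close> grows. For
  \<open>n = 0\<close> it is identically zero.\<close>

definition bump :: "real \<Rightarrow> real \<Rightarrow> nat \<Rightarrow> real \<Rightarrow> real" where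
  "bump a b n t = exp_cutoff (real n * (t - a)) * exp_cutoff (real n * (b - t))"

lemma smooth_bump: "smooth_real (bump a b n)"
proof -
  have "bump a b n =
    (\<lambda>t. exp_cutoff (real n * t + - real n * a) * exp_cutoff (- real n * t + real n * b))"
    by (auto simp: bump_def algebra_simps)
  then show ?thesis
    by (simp only:) (intro smooth_real_mult smooth_real_affine smooth_exp_cutoff)
qed

lemma bump_bounds: "0 \<le> bump a b n t" "bump a b n t \<le> 1"
  by (auto simp: bump_def exp_cutoff_def mult_le_one)

lemma bump_pos: "n > 0 \<Longrightarrow> a < t \<Longrightarrow> t < b \<Longrightarrow> bump a b n t > 0"
  by (auto simp: bump_def exp_cutoff_def)

lemma bump_eq_0: "t \<notin> {a<..<b} \<Longrightarrow> bump a b n t = 0"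
  by (auto simp: bump_def exp_cutoff_def zero_less_mult_iff)

lemma bump_tendsto_indicator: "(\<lambda>n. bump a b n t) \<longlonglongrightarrow> indicator {a<..<b} t"
proof (cases "t \<in> {a<..<b}")
  case True
  have *: "(\<lambda>n. exp_cutoff (real n * y)) \<longlonglongrightarrow> 1" if "y > 0" for y
  proof -
    have "(\<lambda>n. exp (- (1 / (real n * y)))) \<longlonglongrightarrow> 1"
      using that by real_asymp
    then show ?thesis
      by (rule Lim_transform_eventually)
         (auto simp: exp_cutoff_def that intro!: eventually_sequentiallyI[of 1])
  qed
  have "(\<lambda>n. bump a b n t) \<longlonglongrightarrow> 1 * 1"
    unfolding bump_def using True by (intro tendsto_mult *) auto
  then show ?thesis using True by simp
next
  case False
  then show ?thesis by (simp add: bump_eq_0)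
qed

lemma test_functions_smooth:
  "\<phi> \<in> test_functions I \<longleftrightarrow> smooth_real \<phi> \<and> (\<exists>K. compact K \<and> K \<subseteq> I \<and> (\<forall>x. x \<notin> K \<longrightarrow> \<phi> x = 0))"
  by (simp add: test_functions_def smooth_real_def)


section \<open>The Langevin quotient\<close>

text \<open>Everywhere convergent power series are closed under termwise differentiation, which
  replaces the coefficients by \<open>diffs c\<close>.\<close>

lemma smooth_real_power_series:
  assumes "\<And>x. summable (\<lambda>n. c n * x ^ n)"
  shows "smooth_real (\<lambda>x. \<Sum>n. c n * x ^ n)"
proof (rule smooth_real_coinduct)
  let ?F = "{\<lambda>x :: real. \<Sum>n. c n * x ^ n | c. \<forall>x. summable (\<lambda>n. c n * x ^ n)}"
  show "(\<lambda>x. \<Sum>n. c n * x ^ n) \<in> ?F"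
    using assms by blast
  fix g assume "g \<in> ?F"
  then obtain c where g: "g = (\<lambda>x. \<Sum>n. c n * x ^ n)" and c: "\<And>x. summable (\<lambda>n. c n * x ^ n)"
    by blast
  have "\<forall>x. summable (\<lambda>n. diffs c n * x ^ n)"
    using c by (auto intro: termdiff_converges_all)
  moreover have "\<forall>x. (g has_field_derivative (\<Sum>n. diffs c n * x ^ n)) (at x)"
    unfolding g using c by (auto intro: termdiffs_strong_converges_everywhere)
  ultimately show "\<exists>g'\<in>?F. \<forall>x. (g has_field_derivative g' x) (at x)"
    by (intro bexI[of _ "\<lambda>x. \<Sum>n. diffs c n * x ^ n"]) blast+
qed

text \<open>The entire function sinh(sqrt w) / sqrt w, a power series in w because sinh is
  odd.\<close>

definition sinhc :: "real \<Rightarrow> real" where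
  "sinhc w = (\<Sum>k. 1 / fact (2 * k + 1) * w ^ k)"

text \<open>The entire function (y cosh y - sinh y) / y^3 in the variable w = y^2. With y = \<beta>
  z the Langevin quotient is \<beta> times this function over \<open>sinhc\<close>, which removes
  the apparent singularity at the origin.\<close>

definition langevin_num :: "real \<Rightarrow> real" where
  "langevin_num w = (\<Sum>k. (1 / fact (2 * k + 2) - 1 / fact (2 * k + 3)) * w ^ k)"

lemma summable_inverse_fact_le:
  assumes "\<And>k. \<bar>c k\<bar> \<le> 1 / (fact k :: real)"
  shows "summable (\<lambda>k. c k * w ^ k)"
proof (rule summable_comparison_test')
  show "summable (\<lambda>k. inverse (fact k) * \<bar>w\<bar> ^ k)"
    by (rule summable_exp)
  show "norm (c k * w ^ k) \<le> inverse (fact k) * \<bar>w\<bar> ^ k" if "k \<ge> 0" for k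
    using mult_right_mono[OF assms[of k], of "\<bar>w\<bar> ^ k"] by (simp add: abs_mult power_abs inverse_eq_divide)
qed

lemma inverse_fact_le:
  assumes "k \<le> m"
  shows "1 / (fact m :: real) \<le> 1 / fact k"
  using assms by (intro divide_left_mono fact_mono) auto

lemma summable_sinhc: "summable (\<lambda>k. 1 / fact (2 * k + 1) * w ^ k :: real)"
  by (rule summable_inverse_fact_le, subst abs_of_nonneg)
     (auto intro!: inverse_fact_le simp del: fact_Suc)

lemma summable_langevin_num:
  "summable (\<lambda>k. (1 / fact (2 * k + 2) - 1 / fact (2 * k + 3)) * w ^ k :: real)"
proof (rule summable_inverse_fact_le)
  fix k
  have "1 / (fact (2 * k + 3) :: real) \<le> 1 / fact (2 * k + 2)"
    "1 / (fact (2 * k + 2) :: real) \<le> 1 / fact k" "0 \<le> 1 / (fact (2 * k + 3) :: real)"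
    by (auto intro!: inverse_fact_le simp del: fact_Suc)
  then show "\<bar>1 / fact (2 * k + 2) - 1 / fact (2 * k + 3)\<bar> \<le> 1 / (fact k :: real)"
    by linarith
qed

lemma smooth_sinhc: "smooth_real sinhc"
  using smooth_real_power_series[OF summable_sinhc] by (simp add: sinhc_def[abs_def])

lemma smooth_langevin_num: "smooth_real langevin_num"
  using smooth_real_power_series[OF summable_langevin_num] by (simp add: langevin_num_def[abs_def])

section \<open>Identification of the two series and of their quotient\<close>

lemma sinh_sums: "(\<lambda>k. y ^ (2 * k + 1) / fact (2 * k + 1)) sums sinh (y :: real)"
proof -
  have "(\<lambda>k. if even (2 * k + 1) then 0 else y ^ (2 * k + 1) /\<^sub>R fact (2 * k + 1)) sums sinh y
    \<longleftrightarrow> (\<lambda>n. if even n then 0 else y ^ n /\<^sub>R fact n) sums sinh y"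
    by (rule sums_mono_reindex[of "\<lambda>k. 2 * k + 1"]) (auto simp: strict_mono_def elim!: oddE)
  then show ?thesis
    using sinh_converges[of y] by (simp add: divide_inverse mult.commute del: fact_Suc)
qed

lemma cosh_sums: "(\<lambda>k. y ^ (2 * k) / fact (2 * k)) sums cosh (y :: real)"
proof -
  have "(\<lambda>k. if even (2 * k) then y ^ (2 * k) /\<^sub>R fact (2 * k) else 0) sums cosh y
    \<longleftrightarrow> (\<lambda>n. if even n then y ^ n /\<^sub>R fact n else 0) sums cosh y"
    by (rule sums_mono_reindex[of "\<lambda>k. 2 * k"]) (auto simp: strict_mono_def elim!: evenE)
  then show ?thesis
    using cosh_converges[of y] by (simp add: divide_inverse mult.commute del: fact_Suc)
qed

lemma sinhc_square: "y * sinhc (y\<^sup>2) = sinh y"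
proof -
  have "(\<lambda>k. y * (1 / fact (2 * k + 1) * (y\<^sup>2) ^ k)) sums (y * sinhc (y\<^sup>2))"
    unfolding sinhc_def by (intro sums_mult summable_sums summable_sinhc)
  moreover have "(\<lambda>k. y * (1 / fact (2 * k + 1) * (y\<^sup>2) ^ k)) = (\<lambda>k. y ^ (2 * k + 1) / fact (2 * k + 1))"
    by (simp add: power_mult)
  ultimately show ?thesis
    using sinh_sums[of y] sums_unique2 by metis
qed

lemma langevin_num_square: "y ^ 3 * langevin_num (y\<^sup>2) = y * cosh y - sinh y"
proof -
  \<comment> \<open>The leading terms 1 of cosh and y of sinh cancel in y cosh y - sinh y. Without
    them every term is divisible by y^3.\<close>
  have c: "(\<lambda>k. y ^ (2 * Suc k) / fact (2 * Suc k)) sums (cosh y - 1)"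
    using cosh_sums[of y] by (subst sums_Suc_iff) simp
  have s: "(\<lambda>k. y ^ (2 * Suc k + 1) / fact (2 * Suc k + 1)) sums (sinh y - y)"
    using sinh_sums[of y] by (subst sums_Suc_iff) simp
  have 1: "(\<lambda>k. y * (y ^ (2 * Suc k) / fact (2 * Suc k)) - y ^ (2 * Suc k + 1) / fact (2 * Suc k + 1))
    sums (y * (cosh y - 1) - (sinh y - y))"
    by (intro sums_diff sums_mult c s)
  have 2: "y * (y ^ (2 * Suc k) / fact (2 * Suc k)) - y ^ (2 * Suc k + 1) / fact (2 * Suc k + 1)
     = y ^ 3 * ((1 / fact (2 * k + 2) - 1 / fact (2 * k + 3)) * (y\<^sup>2) ^ k)" for k
  proof -
    have e: "2 * Suc k = 2 * k + 2" "2 * k + 2 + 1 = 2 * k + 3" by auto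
    have p: "y ^ 3 * (y\<^sup>2) ^ k = y ^ (2 * k + 3)" "y * y ^ (2 * k + 2) = y ^ (2 * k + 3)"
      by (metis power_mult power_add add.commute, simp add: eval_nat_numeral)
    have *: "y * (Y / c) - Z / d = X * ((1 / c - 1 / d) * W)"
      if "X * W = Z" "y * Y = Z" for X Y Z W c d :: real
    proof -
      have "y * (Y / c) = Z / c" using that(2) by simp
      moreover have "X * ((1 / c - 1 / d) * W) = Z * (1 / c - 1 / d)"
        by (simp add: that(1)[symmetric])
      ultimately show ?thesis by (simp add: right_diff_distrib)
    qed
    show ?thesis
      unfolding e by (rule *[OF p])
  qed
  have 3: "(\<lambda>k. y ^ 3 * ((1 / fact (2 * k + 2) - 1 / fact (2 * k + 3)) * (y\<^sup>2) ^ k))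
    sums (y ^ 3 * langevin_num (y\<^sup>2))"
    unfolding langevin_num_def by (intro sums_mult summable_sums summable_langevin_num)
  show ?thesis
    using sums_unique2[OF 1[unfolded 2] 3] by (simp add: algebra_simps)
qed

lemma sinhc_0: "sinhc 0 = 1" and langevin_num_0: "langevin_num 0 = 1 / 3"
  unfolding sinhc_def langevin_num_def by (subst powser_zero; simp add: fact_numeral)+

text \<open>On the positive axis the sign is that of sinh. For negative w the function is
  sin(sqrt(-w)) / sqrt(-w), which has zeros; this is why the derivatives below are asserted for
  \<open>w \<ge> 0\<close> only.\<close>

lemma sinhc_pos:
  assumes "w \<ge> 0"
  shows "sinhc w > 0"
proof (cases "w = 0")
  case False
  then have "sqrt w * sinhc w = sinh (sqrt w)" "sqrt w > 0" "sinh (sqrt w) > 0"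
    using sinhc_square[of "sqrt w"] assms by auto
  then show ?thesis by (metis zero_less_mult_pos)
qed (simp add: sinhc_0)

lemma langevin_quotient_eq:
  assumes "\<beta> > 0"
  shows "langevin_quotient \<beta> z = \<beta> * langevin_num (\<beta>\<^sup>2 * z\<^sup>2) / sinhc (\<beta>\<^sup>2 * z\<^sup>2)"
proof (cases "z = 0")
  case False
  define y where "y = \<beta> * z"
  have y: "y \<noteq> 0" "z = y / \<beta>" "sinh y \<noteq> 0" using False assms by (auto simp: y_def)
  have w: "\<beta>\<^sup>2 * z\<^sup>2 = y\<^sup>2" by (simp add: y_def power_mult_distrib)
  have l: "langevin_num (y\<^sup>2) = (y * cosh y - sinh y) / y ^ 3" and s: "sinhc (y\<^sup>2) = sinh y / y"
    using langevin_num_square[of y] sinhc_square[of y] y by (auto simp: field_simps)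
  have "langevin_quotient \<beta> z = (cosh y / sinh y - 1 / y) / z"
    using False by (simp add: langevin_quotient_def langevin_def y_def)
  also have "\<dots> = \<beta> * langevin_num (y\<^sup>2) / sinhc (y\<^sup>2)"
    unfolding l s y(2) using y(1,3) assms by (simp add: field_simps power3_eq_cube)
  finally show ?thesis by (simp add: w)
qed (simp add: langevin_quotient_def sinhc_0 langevin_num_0)

text \<open>The numerators \<open>P k\<close> in \<open>(A / B)\<^bsup>(k)\<^esup> = P k / B\<^bsup>k + 1\<^esup>\<close>.\<close>

primrec quotient_deriv_num :: "(real \<Rightarrow> real) \<Rightarrow> (real \<Rightarrow> real) \<Rightarrow> nat \<Rightarrow> real \<Rightarrow> real" where
  "quotient_deriv_num A B 0 = A"
| "quotient_deriv_num A B (Suc k) = (\<lambda>x. deriv (quotient_deriv_num A B k) x * B x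
      - real (Suc k) * (quotient_deriv_num A B k x * deriv B x))"

lemma quotient_deriv_num:
  assumes "smooth_real A" "smooth_real B" "B x \<noteq> 0"
  shows "((\<lambda>x. quotient_deriv_num A B k x / B x ^ Suc k) has_field_derivative
           quotient_deriv_num A B (Suc k) x / B x ^ Suc (Suc k)) (at x)"
proof -
  have "smooth_real (quotient_deriv_num A B k)"
    by (induction k) (auto intro!: assms smooth_real_diff_cmult smooth_real_mult smooth_real_deriv)
  note D = smooth_real_deriv(2)[OF this, of x] smooth_real_deriv(2)[OF assms(2), of x]
  have "((\<lambda>x. B x ^ Suc k) has_field_derivative real (Suc k) * (deriv B x * B x ^ k)) (at x)"
    using DERIV_power[OF D(2), of "Suc k"] by simp
  from DERIV_divide[OF D(1) this]
  have 1: "((\<lambda>x. quotient_deriv_num A B k x / B x ^ Suc k) has_field_derivative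
      (deriv (quotient_deriv_num A B k) x * B x ^ Suc k
        - quotient_deriv_num A B k x * (real (Suc k) * (deriv B x * B x ^ k)))
      / (B x ^ Suc k * B x ^ Suc k)) (at x)"
    using assms(3) by simp
  \<comment> \<open>The quotient rule squares the denominator; cancelling \<open>b ^ k\<close>
    brings the exponent back to \<open>Suc (Suc k)\<close>.\<close>
  have 2: "(p' * b ^ Suc k - p * (c * (b' * b ^ k))) / (b ^ Suc k * b ^ Suc k)
      = (p' * b - c * (p * b')) / b ^ Suc (Suc k)" if "b \<noteq> 0" for p p' b b' c :: real
  proof -
    have "p' * b ^ Suc k - p * (c * (b' * b ^ k)) = b ^ k * (p' * b - c * (p * b'))"
      "b ^ Suc k * b ^ Suc k = b ^ k * b ^ Suc (Suc k)"
      by (simp_all add: algebra_simps)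
    then show ?thesis using that by simp
  qed
  show ?thesis
    using DERIV_cong[OF 1 2[OF assms(3)]] by (simp only: quotient_deriv_num.simps)
qed

text \<open>The derivatives are recorded as a sequence of explicit quotients rather than as iterated
  \<open>deriv\<close>, because the denominator has zeros at negative arguments and the function is
  not smooth on the whole line.\<close>

lemma langevin_quotient_smooth:
  assumes "\<beta> > 0"
  obtains \<phi> :: "nat \<Rightarrow> real \<Rightarrow> real" where
    "\<And>k w. w \<ge> 0 \<Longrightarrow> (\<phi> k has_field_derivative \<phi> (Suc k) w) (at w)"
    "\<And>z. langevin_quotient \<beta> z = \<phi> 0 (z\<^sup>2)"
proof
  \<comment> \<open>The forms \<open>0 - (- \<beta>) * _\<close> and \<open>_ + 0\<close> match
    \<open>smooth_real_diff_cmult\<close> and \<open>smooth_real_affine\<close>.\<close>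
  define A where "A = (\<lambda>w. 0 - (- \<beta>) * langevin_num (\<beta>\<^sup>2 * w + 0))"
  define B where "B = (\<lambda>w. sinhc (\<beta>\<^sup>2 * w + 0))"
  have "smooth_real A" "smooth_real B"
    unfolding A_def B_def
    by (intro smooth_real_diff_cmult smooth_real_const smooth_real_affine smooth_sinhc smooth_langevin_num)+
  moreover have "B w \<noteq> 0" if "w \<ge> 0" for w
    using sinhc_pos[of "\<beta>\<^sup>2 * w"] that by (simp add: B_def)
  ultimately show "((\<lambda>w. quotient_deriv_num A B k w / B w ^ Suc k) has_field_derivative
           quotient_deriv_num A B (Suc k) w / B w ^ Suc (Suc k)) (at w)" if "w \<ge> 0" for k w
    using that by (intro quotient_deriv_num)
  show "langevin_quotient \<beta> z = quotient_deriv_num A B 0 (z\<^sup>2) / B (z\<^sup>2) ^ Suc 0" for z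
    by (simp add: langevin_quotient_eq[OF assms] A_def B_def)
qed

text \<open>The constant is uniform in the argument and in the expansion point, because
  \<open>\<phi> M\<close> is bounded on a compact interval. Expanding a sequence of derivatives
  makes the result applicable to the shifted sequence, that is, to the first derivative.\<close>

lemma taylor_remainder_bound:
  fixes \<phi> :: "nat \<Rightarrow> real \<Rightarrow> real"
  assumes "\<And>k w. w \<ge> 0 \<Longrightarrow> (\<phi> k has_field_derivative \<phi> (Suc k) w) (at w)" "M > 0"
  obtains B where "B \<ge> 0" "\<And>w w'. w \<in> {0..W} \<Longrightarrow> w' \<in> {0..W} \<Longrightarrow>
    \<bar>\<phi> 0 w - (\<Sum>k<M. \<phi> k w' / fact k * (w - w') ^ k)\<bar> \<le> B * \<bar>w - w'\<bar> ^ M"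
proof -
  obtain m where m: "M = Suc m" using assms(2) gr0_conv_Suc by blast
  have "continuous_on {0..W} (\<phi> M)"
    using DERIV_isCont[OF assms(1)] by (intro continuous_at_imp_continuous_on) auto
  then have "bounded (\<phi> M ` {0..W})"
    by (intro compact_imp_bounded compact_continuous_image) auto
  then obtain C where C: "\<And>w. w \<in> {0..W} \<Longrightarrow> norm (\<phi> M w) \<le> C" "C > 0"
    unfolding bounded_pos by blast
  show ?thesis
  proof
    show "0 \<le> C / fact m" using C(2) by simp
    fix w w' assume w: "w \<in> {0..W}" "w' \<in> {0..W}"
    have "norm (\<phi> 0 w - (\<Sum>i\<le>m. \<phi> i w' * (w - w') ^ i / fact i)) \<le> C * norm (w - w') ^ Suc m / fact m"
      by (rule field_Taylor[where S = "{0..W}"])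
         (use C m w assms(1) in \<open>auto intro: has_field_derivative_at_within\<close>)
    then show "\<bar>\<phi> 0 w - (\<Sum>k<M. \<phi> k w' / fact k * (w - w') ^ k)\<bar> \<le> C / fact m * \<bar>w - w'\<bar> ^ M"
      by (simp add: m lessThan_Suc_atMost)
  qed
qed


section \<open>Singular values and finite rank\<close>

inductive_set lspan :: "('a \<Rightarrow> real) set \<Rightarrow> ('a \<Rightarrow> real) set" for S where
  zero: "(\<lambda>x. 0) \<in> lspan S"
| step: "f \<in> S \<Longrightarrow> g \<in> lspan S \<Longrightarrow> (\<lambda>x. c * f x + g x) \<in> lspan S"

lemma lspan_base: "f \<in> S \<Longrightarrow> f \<in> lspan S"
  using lspan.step[OF _ lspan.zero, of f S 1] by simp

lemma lspan_add:
  assumes "f \<in> lspan S" "g \<in> lspan S"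
  shows "(\<lambda>x. f x + g x) \<in> lspan S"
  using assms(1)
proof induction
  case (step f h c)
  then show ?case using lspan.step[of f S "\<lambda>x. h x + g x" c] by (simp add: add.assoc)
qed (use assms in simp)

lemma lspan_cmult: "f \<in> lspan S \<Longrightarrow> (\<lambda>x. c * f x) \<in> lspan S"
proof (induction rule: lspan.induct)
  case (step f h d)
  then show ?case using lspan.step[of f S "\<lambda>x. c * h x" "c * d"] by (simp add: algebra_simps)
qed (use lspan.zero in simp)

lemma lspan_cmult': "f \<in> lspan S \<Longrightarrow> (\<lambda>x. f x * c) \<in> lspan S"
  using lspan_cmult[of f S c] by (simp add: mult.commute)

lemma lspan_diff: "f \<in> lspan S \<Longrightarrow> g \<in> lspan S \<Longrightarrow> (\<lambda>x. f x - g x) \<in> lspan S"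
  using lspan_add[OF _ lspan_cmult[of g S "-1"], of f] by simp

lemma lspan_sum: "(\<And>i. i \<in> I \<Longrightarrow> f i \<in> lspan S) \<Longrightarrow> (\<lambda>x. \<Sum>i\<in>I. f i x) \<in> lspan S"
  by (induction I rule: infinite_finite_induct) (auto intro: lspan.zero lspan_add)

lemma lspan_mono: "f \<in> lspan S \<Longrightarrow> S \<subseteq> S' \<Longrightarrow> f \<in> lspan S'"
  by (induction rule: lspan.induct) (auto intro: lspan.intros)

text \<open>Generators for the products of members of two spans. Their number is at most the product
  of the numbers of generators, and this is how the rank is counted.\<close>

definition fun_products :: "('a \<Rightarrow> real) set \<Rightarrow> ('a \<Rightarrow> real) set \<Rightarrow> ('a \<Rightarrow> real) set" where
  "fun_products S S' = (\<lambda>(f, g) x. f x * g x) ` (S \<times> S')"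

lemma lspan_mult:
  assumes "f \<in> lspan S" "g \<in> lspan S'"
  shows "(\<lambda>x. f x * g x) \<in> lspan (fun_products S S')"
  using assms(1)
proof induction
  case zero
  then show ?case using lspan.zero by simp
next
  case (step f h c)
  have "(\<lambda>x. f x * g x) \<in> lspan (fun_products S S')"
    using assms(2)
  proof induction
    case zero
    then show ?case using lspan.zero by simp
  next
    case (step g k d)
    have "(\<lambda>x. f x * g x) \<in> fun_products S S'"
      using step \<open>f \<in> S\<close> by (force simp: fun_products_def)
    then show ?case
      using lspan.step[OF _ step(3)] by (force simp: algebra_simps)
  qed
  then show ?case
    using lspan_add[OF lspan_cmult step(3)] by (force simp: algebra_simps)
qed

lemma finite_fun_products: "finite S \<Longrightarrow> finite S' \<Longrightarrow> finite (fun_products S S')"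
  by (simp add: fun_products_def)

lemma card_fun_products_le:
  assumes "finite S" "finite S'"
  shows "card (fun_products S S') \<le> card S * card S'"
  unfolding fun_products_def using card_image_le[of "S \<times> S'"] assms by (simp add: card_cartesian_product)

text \<open>Gaussian elimination by induction on the equations. A nonzero coefficient
  \<open>a k j\<close> of the new equation is the pivot that eliminates the unknown \<open>j\<close>
  from the others; without such a coefficient the new equation holds trivially.\<close>

lemma homogeneous_system_solution:
  fixes a :: "'k \<Rightarrow> 'i \<Rightarrow> real"
  assumes "finite K" "finite I" "card K < card I"
  obtains c where "\<exists>i\<in>I. c i \<noteq> 0" "\<And>k. k \<in> K \<Longrightarrow> (\<Sum>i\<in>I. c i * a k i) = 0"
proof -
  have "\<exists>c. (\<exists>i\<in>I. c i \<noteq> 0) \<and> (\<forall>k\<in>K. (\<Sum>i\<in>I. c i * a k i) = 0)"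
    using assms
  proof (induction K arbitrary: I a rule: finite_induct)
    case empty
    then have "I \<noteq> {}" by auto
    then show ?case by (intro exI[of _ "\<lambda>_. 1"]) auto
  next
    case (insert k K)
    show ?case
    proof (cases "\<forall>i\<in>I. a k i = 0")
      case True
      moreover obtain c where "\<exists>i\<in>I. c i \<noteq> 0" "\<forall>k\<in>K. (\<Sum>i\<in>I. c i * a k i) = 0"
        using insert.IH[of I a] insert.prems insert.hyps by auto
      ultimately show ?thesis by (intro exI[of _ c]) auto
    next
      case False
      then obtain j where j: "j \<in> I" "a k j \<noteq> 0" by blast
      define I' where "I' = I - {j}"
      have I: "I = insert j I'" "j \<notin> I'" "finite I'" using j insert.prems by (auto simp: I'_def)
      have "card K < card I'"
        using insert.prems insert.hyps I by auto
      then obtain c where c: "\<exists>i\<in>I'. c i \<noteq> 0"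
          "\<forall>l\<in>K. (\<Sum>i\<in>I'. c i * (a l i - a l j * a k i / a k j)) = 0"
        using insert.IH[of I' "\<lambda>l i. a l i - a l j * a k i / a k j"] I(3) by auto
      define s where "s = (\<Sum>i\<in>I'. c i * a k i)"
      \<comment> \<open>The eliminated unknown is recovered from equation \<open>k\<close>.\<close>
      define c' where "c' = c(j := - s / a k j)"
      have sum: "(\<Sum>i\<in>I. c' i * a l i) = - s / a k j * a l j + (\<Sum>i\<in>I'. c i * a l i)" for l
        using I by (auto simp: c'_def intro!: sum.cong)
      have "(\<Sum>i\<in>I. c' i * a l i) = 0" if "l \<in> insert k K" for l
      proof (cases "l = k")
        case True
        then show ?thesis using j by (simp add: sum s_def)
      next
        case False
        have "(\<Sum>i\<in>I'. c i * (a l i - a l j * a k i / a k j)) =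
              (\<Sum>i\<in>I'. c i * a l i) - a l j / a k j * s"
          by (simp add: s_def right_diff_distrib sum_subtractf sum_distrib_left sum_divide_distrib mult_ac)
        then have "(\<Sum>i\<in>I'. c i * a l i) = a l j / a k j * s"
          using c(2) that False by simp
        then show ?thesis by (simp add: sum)
      qed
      moreover have "\<exists>i\<in>I. c' i \<noteq> 0"
        using c(1) I by (auto simp: c'_def)
      ultimately show ?thesis by blast
    qed
  qed
  then show ?thesis using that by blast
qed

section \<open>Square-integrable functions\<close>

lemma l2_measurable: "f \<in> l2 M \<Longrightarrow> f \<in> borel_measurable M"
  and l2_square_integrable: "f \<in> l2 M \<Longrightarrow> integrable M (\<lambda>x. (f x)\<^sup>2)"
  by (auto simp: l2_def)

lemma l2_mult_integrable:
  assumes "f \<in> l2 M" "g \<in> l2 M"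
  shows "integrable M (\<lambda>x. f x * g x)"
proof (rule Bochner_Integration.integrable_bound)
  show "integrable M (\<lambda>x. (f x)\<^sup>2 + (g x)\<^sup>2)"
    using assms by (auto intro: l2_square_integrable)
  show "(\<lambda>x. f x * g x) \<in> borel_measurable M"
    using assms l2_measurable by (intro borel_measurable_times)
  have "\<bar>a * b\<bar> \<le> a\<^sup>2 + b\<^sup>2" for a b :: real
  proof -
    have "0 \<le> (\<bar>a\<bar> - \<bar>b\<bar>)\<^sup>2" "0 \<le> \<bar>a\<bar> * \<bar>b\<bar>" by auto
    then have "2 * (\<bar>a\<bar> * \<bar>b\<bar>) \<le> a\<^sup>2 + b\<^sup>2"
      by (simp add: power2_diff mult.assoc)
    then show ?thesis using \<open>0 \<le> \<bar>a\<bar> * \<bar>b\<bar>\<close> unfolding abs_mult by linarith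
  qed
  then show "AE x in M. norm (f x * g x) \<le> norm ((f x)\<^sup>2 + (g x)\<^sup>2)"
    by (auto intro!: AE_I2)
qed

lemma l2_cmult: "f \<in> l2 M \<Longrightarrow> (\<lambda>x. c * f x) \<in> l2 M"
  by (auto simp: l2_def power_mult_distrib)

lemma l2_add: "f \<in> l2 M \<Longrightarrow> g \<in> l2 M \<Longrightarrow> (\<lambda>x. f x + g x) \<in> l2 M"
  using l2_mult_integrable[of f M g]
  by (auto simp: l2_def power2_sum mult.assoc intro!: Bochner_Integration.integrable_add)

lemma l2_sum: "(\<And>i. i \<in> I \<Longrightarrow> f i \<in> l2 M) \<Longrightarrow> (\<lambda>x. \<Sum>i\<in>I. f i x) \<in> l2 M"
proof (induction I rule: infinite_finite_induct)
  case (insert i I)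
  then show ?case using l2_add[of "f i" M] by auto
qed (auto simp: l2_def)

lemma l2_dominated:
  assumes "b \<in> l2 M" "f \<in> borel_measurable M" "\<And>x. x \<in> space M \<Longrightarrow> \<bar>f x\<bar> \<le> b x"
  shows "f \<in> l2 M"
proof -
  have "integrable M (\<lambda>x. (f x)\<^sup>2)"
    by (rule Bochner_Integration.integrable_bound[OF l2_square_integrable[OF assms(1)]])
       (use assms in \<open>auto intro!: AE_I2 intro: order_trans[OF _ abs_ge_self]
         simp: abs_le_square_iff[symmetric]\<close>)
  then show ?thesis using assms by (simp add: l2_def)
qed

lemma l2_inner_sum_left:
  assumes "\<And>i. i \<in> I \<Longrightarrow> f i \<in> l2 M" "g \<in> l2 M"
  shows "l2_inner M (\<lambda>x. \<Sum>i\<in>I. c i * f i x) g = (\<Sum>i\<in>I. c i * l2_inner M (f i) g)"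
proof -
  have "l2_inner M (\<lambda>x. \<Sum>i\<in>I. c i * f i x) g = (LINT x|M. (\<Sum>i\<in>I. c i * (f i x * g x)))"
    by (simp add: l2_inner_def sum_distrib_right mult.assoc)
  also have "\<dots> = (\<Sum>i\<in>I. c i * l2_inner M (f i) g)"
    using assms by (subst Bochner_Integration.integral_sum) (auto simp: l2_inner_def l2_mult_integrable)
  finally show ?thesis .
qed

context finite_measure
begin

lemma const_l2: "(\<lambda>x. c) \<in> l2 M"
  by (simp add: l2_def)

lemma l2_integrable: "f \<in> l2 M \<Longrightarrow> integrable M f"
  using l2_mult_integrable[OF _ const_l2, of f 1] by simp

text \<open>This is the Cauchy-Schwarz inequality for \<open>f\<close> and a constant, read off from
  the nonnegative integral of \<open>(\<bar>f x\<bar> - l)\<^sup>2\<close>. The choice of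
  \<open>l\<close> is close to the minimizing one; the added 1 keeps the denominator positive when
  the measure is zero.\<close>

lemma l2_abs_integral_le:
  assumes "f \<in> l2 M"
  shows "(LINT x|M. \<bar>f x\<bar>)\<^sup>2 \<le> (measure M (space M) + 1) * (LINT x|M. (f x)\<^sup>2)"
proof -
  define m where "m = measure M (space M)"
  define a where "a = (LINT x|M. \<bar>f x\<bar>)"
  define l where "l = a / (m + 1)"
  have m: "m \<ge> 0" by (simp add: m_def)
  have "0 \<le> (LINT x|M. (\<bar>f x\<bar> - l)\<^sup>2)" by simp
  also have "\<dots> = (LINT x|M. (f x)\<^sup>2 - 2 * l * \<bar>f x\<bar> + l\<^sup>2)"
    by (simp add: power2_diff algebra_simps)
  also have "\<dots> = (LINT x|M. (f x)\<^sup>2) - 2 * l * a + l\<^sup>2 * m"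
    using l2_integrable[OF assms] l2_square_integrable[OF assms] by (simp add: a_def m_def)
  finally have "0 \<le> (LINT x|M. (f x)\<^sup>2) - 2 * l * a + l\<^sup>2 * m" .
  moreover have "l\<^sup>2 * m \<le> l\<^sup>2 * (m + 1)" by (simp add: algebra_simps)
  moreover have "l\<^sup>2 * (m + 1) = l * a" "l * a = a\<^sup>2 / (m + 1)"
    using m by (simp_all add: l_def power2_eq_square)
  ultimately have "a\<^sup>2 / (m + 1) \<le> (LINT x|M. (f x)\<^sup>2)" by linarith
  then show ?thesis using m by (simp add: a_def[symmetric] m_def[symmetric] field_simps)
qed

end

text \<open>Integrability is carried along with orthogonality because the inductive step uses
  additivity of the integral.\<close>

lemma lspan_integrable_mult:
  assumes "g \<in> lspan S" "\<And>a. a \<in> S \<Longrightarrow> integrable M (\<lambda>x. f x * a x)"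
    "\<And>a. a \<in> S \<Longrightarrow> (LINT x|M. f x * a x) = 0"
  shows "integrable M (\<lambda>x. f x * g x) \<and> (LINT x|M. f x * g x) = 0"
  using assms(1)
proof induction
  case (step g h c)
  have "(\<lambda>x. f x * (c * g x + h x)) = (\<lambda>x. c * (f x * g x) + f x * h x)"
    by (simp add: algebra_simps)
  then show ?case
    using step assms(2,3)[of g] by simp
qed simp

lemma (in pair_sigma_finite) integrable_tensor_product:
  fixes f g :: "_ \<Rightarrow> real"
  assumes "integrable M1 f" "integrable M2 g"
  shows "integrable (M1 \<Otimes>\<^sub>M M2) (\<lambda>z. f (fst z) * g (snd z))"
proof (rule Fubini_integrable)
  have [measurable]: "f \<in> borel_measurable M1" "g \<in> borel_measurable M2"
    using assms by auto
  show "(\<lambda>z. f (fst z) * g (snd z)) \<in> borel_measurable (M1 \<Otimes>\<^sub>M M2)"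
    by measurable
qed (use assms in \<open>auto simp: abs_mult\<close>)

text \<open>The bound is uniform in \<open>x\<close> and square integrable in \<open>t\<close>, the
  shape produced by bounded g and p and a square-integrable h'.\<close>

locale l2_kernel = M: finite_measure M + N: finite_measure N
  for M :: "'a measure" and N :: "'b measure" +
  fixes K :: "'a \<Rightarrow> 'b \<Rightarrow> real" and b :: "'b \<Rightarrow> real"
  assumes K_measurable: "(\<lambda>(x, t). K x t) \<in> borel_measurable (M \<Otimes>\<^sub>M N)"
    and b_l2: "b \<in> l2 N"
    and K_bound: "\<And>x t. x \<in> space M \<Longrightarrow> t \<in> space N \<Longrightarrow> \<bar>K x t\<bar> \<le> b t"
begin

lemma K_section_measurable [measurable]: "t \<in> space N \<Longrightarrow> (\<lambda>x. K x t) \<in> borel_measurable M"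
  using measurable_compose[OF measurable_Pair2' K_measurable] by simp

lemma mult_K_integrable:
  assumes "c \<in> l2 M" "t \<in> space N"
  shows "integrable M (\<lambda>x. c x * K x t)"
proof (rule l2_mult_integrable[OF assms(1)])
  show "(\<lambda>x. K x t) \<in> l2 M"
    by (rule l2_dominated[OF M.const_l2[of "b t"]]) (use assms K_bound in auto)
qed

lemma integral_operator_bound:
  assumes "c \<in> l2 M" "t \<in> space N"
  shows "\<bar>integral_operator M K c t\<bar> \<le> (LINT x|M. \<bar>c x\<bar>) * b t"
proof -
  have "\<bar>integral_operator M K c t\<bar> \<le> (LINT x|M. \<bar>c x * K x t\<bar>)"
    unfolding integral_operator_def by (rule integral_abs_bound)
  also have "\<dots> \<le> (LINT x|M. \<bar>c x\<bar> * b t)"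
    using integrable_abs[OF mult_K_integrable[OF assms]] M.l2_integrable[OF assms(1)] K_bound assms(2)
    by (intro integral_mono) (auto simp: abs_mult intro!: mult_left_mono)
  finally show ?thesis by simp
qed

lemma integral_operator_l2:
  assumes "c \<in> l2 M"
  shows "integral_operator M K c \<in> l2 N"
proof (rule l2_dominated)
  show "(\<lambda>t. (LINT x|M. \<bar>c x\<bar>) * b t) \<in> l2 N"
    by (intro l2_cmult b_l2)
  have [measurable]: "c \<in> borel_measurable M" using assms l2_measurable by blast
  note [measurable] = K_measurable
  have "(\<lambda>(t, x). K x t) \<in> borel_measurable (N \<Otimes>\<^sub>M M)"
    using measurable_pair_swap[OF K_measurable] by simp
  then have "(\<lambda>(t, x). c x * K x t) \<in> borel_measurable (N \<Otimes>\<^sub>M M)"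
    unfolding split_beta by measurable
  then show "integral_operator M K c \<in> borel_measurable N"
    unfolding integral_operator_def by (rule M.borel_measurable_lebesgue_integral)
qed (use assms integral_operator_bound in auto)

text \<open>Since \<open>l2_adjoint\<close> is chosen by \<open>SOME\<close>, its defining identity
  is available only once a witness is exhibited. By Fubini the operator with the transposed kernel
  is one.\<close>

lemma adjoint_exists:
  assumes "v \<in> l2 N"
  shows "\<exists>w\<in>l2 M. \<forall>c\<in>l2 M. l2_inner N (integral_operator M K c) v = l2_inner M c w"
proof
  have [measurable]: "v \<in> borel_measurable N" using assms l2_measurable by blast
  note [measurable] = K_measurable
  interpret P: pair_sigma_finite M N ..
  define w where "w = (\<lambda>x. LINT t|N. K x t * v t)"
  have bv: "integrable N (\<lambda>t. b t * \<bar>v t\<bar>)"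
    using l2_mult_integrable[OF b_l2, of "\<lambda>t. \<bar>v t\<bar>"] assms by (simp add: l2_def)
  have Kv: "integrable N (\<lambda>t. K x t * v t)" if "x \<in> space M" for x
    by (rule Bochner_Integration.integrable_bound[OF bv])
       (use that K_bound measurable_compose[OF measurable_Pair1'[OF that] K_measurable] in
         \<open>force simp: abs_mult intro!: AE_I2 mult_mono\<close>)+
  show "w \<in> l2 M"
  proof (rule l2_dominated[OF M.const_l2])
    show "w \<in> borel_measurable M"
      unfolding w_def by (rule N.borel_measurable_lebesgue_integral) (simp add: split_beta)
    fix x assume x: "x \<in> space M"
    have "\<bar>w x\<bar> \<le> (LINT t|N. \<bar>K x t * v t\<bar>)"
      unfolding w_def by (rule integral_abs_bound)
    also have "\<dots> \<le> (LINT t|N. b t * \<bar>v t\<bar>)"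
      using integrable_abs[OF Kv[OF x]] bv K_bound x by (intro integral_mono) (auto simp: abs_mult intro!: mult_right_mono)
    finally show "\<bar>w x\<bar> \<le> (LINT t|N. b t * \<bar>v t\<bar>)" .
  qed
  show "\<forall>c\<in>l2 M. l2_inner N (integral_operator M K c) v = l2_inner M c w"
  proof
    fix c assume c: "c \<in> l2 M"
    then have [measurable]: "c \<in> borel_measurable M" using l2_measurable by blast
    have "integrable (M \<Otimes>\<^sub>M N) (\<lambda>(x, t). c x * K x t * v t)"
    proof (rule Bochner_Integration.integrable_bound)
      show "integrable (M \<Otimes>\<^sub>M N) (\<lambda>z. \<bar>c (fst z)\<bar> * (b (snd z) * \<bar>v (snd z)\<bar>))"
        using P.integrable_tensor_product[OF integrable_abs[OF M.l2_integrable[OF c]] bv] .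
      show "AE z in M \<Otimes>\<^sub>M N. norm (case z of (x, t) \<Rightarrow> c x * K x t * v t)
         \<le> norm (\<bar>c (fst z)\<bar> * (b (snd z) * \<bar>v (snd z)\<bar>))"
        using K_bound
        by (intro AE_I2)
           (force simp: space_pair_measure abs_mult mult.assoc intro!: mult_left_mono mult_right_mono
             intro: order_trans)
    qed (simp add: split_beta)
    then have "(LINT x|M. LINT t|N. c x * K x t * v t) = (LINT t|N. LINT x|M. c x * K x t * v t)"
      using P.Fubini_integral[of "\<lambda>x t. c x * K x t * v t"] by simp
    then show "l2_inner N (integral_operator M K c) v = l2_inner M c w"
      unfolding l2_inner_def integral_operator_def w_def integral_mult_left_zero
        mult.assoc[of "c _"] integral_mult_right_zero
      by (simp add: mult.assoc[symmetric])
  qed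
qed

text \<open>If f is orthogonal to \<open>S\<close>, the approximant of the kernel integrates to zero
  against it, and only the error \<epsilon> b(t) times the L^1 norm of f remains. The approximant is
  chosen for each \<open>t\<close> separately, so it need not be measurable in \<open>t\<close>.
  Equality of \<open>F\<close> with the kernel operator almost everywhere suffices, as only inner
  products are compared.\<close>

lemma singular_value_le:
  assumes F_AE: "\<And>c. c \<in> l2 M \<Longrightarrow> AE t in N. F c t = integral_operator M K c t"
    and F_measurable: "\<And>c. c \<in> l2 M \<Longrightarrow> F c \<in> borel_measurable N"
    and S: "finite S" "card S < n"
    and S_l2: "\<And>a. a \<in> S \<Longrightarrow> a \<in> l2 M"
    and "\<epsilon> \<ge> 0"
    and approx: "\<And>t. t \<in> space N \<Longrightarrow> \<exists>f\<in>lspan S. \<forall>x\<in>space M. \<bar>K x t - f x\<bar> \<le> \<epsilon> * b t"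
  shows "singular_value M N F n
    \<le> \<epsilon> * sqrt ((measure M (space M) + 1) * (LINT t|N. (b t)\<^sup>2))"
proof -
  define G where "G = integral_operator M K"
  define m where "m = measure M (space M) + 1"
  define \<beta> where "\<beta> = (LINT t|N. (b t)\<^sup>2)"
  have m: "m > 0" by (simp add: m_def add_nonneg_pos)
  have \<beta>: "\<beta> \<ge> 0" by (simp add: \<beta>_def)
  have F_l2: "F c \<in> l2 N" if "c \<in> l2 M" for c
  proof -
    have "integrable N (\<lambda>t. (F c t)\<^sup>2) \<longleftrightarrow> integrable N (\<lambda>t. (G c t)\<^sup>2)"
      using F_AE[OF that] F_measurable[OF that] integral_operator_l2[OF that]
      by (intro integrable_cong_AE) (auto simp: G_def l2_def)
    then show ?thesis
      using F_measurable[OF that] integral_operator_l2[OF that] by (auto simp: l2_def G_def)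
  qed
  have F_inner: "l2_inner N (F c) v = l2_inner N (G c) v" if "c \<in> l2 M" "v \<in> l2 N" for c v
    unfolding l2_inner_def
    using F_AE[OF that(1)] F_measurable[OF that(1)] integral_operator_l2[OF that(1)] that(2)
    by (intro integral_cong_AE) (auto simp: G_def l2_def)
  have adjoint: "l2_inner N (F c) v = l2_inner M c (l2_adjoint M N F v)"
    "l2_adjoint M N F v \<in> l2 M" if v: "v \<in> l2 N" and c: "c \<in> l2 M" for c v
  proof -
    have "\<exists>w. w \<in> l2 M \<and> (\<forall>c\<in>l2 M. l2_inner N (F c) v = l2_inner M c w)"
      using adjoint_exists[OF v] F_inner v by (auto simp: G_def)
    from someI_ex[OF this] show "l2_inner N (F c) v = l2_inner M c (l2_adjoint M N F v)"
      "l2_adjoint M N F v \<in> l2 M"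
      using c by (auto simp: l2_adjoint_def)
  qed
  have bound: "\<sigma> \<le> \<epsilon> * sqrt (m * \<beta>)" if \<sigma>: "0 \<le> \<sigma>" "n_singular_values_ge M N F n \<sigma>" for \<sigma>
  proof -
    obtain e ev where "\<forall>i<n. e i \<in> l2 M"
        "\<forall>i<n. \<forall>j<n. l2_inner M (e i) (e j) = (if i = j then 1 else 0)"
        "\<forall>i<n. (AE x in M. l2_adjoint M N F (F (e i)) x = ev i * e i x) \<and> \<sigma> \<le> sqrt (ev i)"
      using \<sigma>(2) unfolding n_singular_values_ge_def by (elim exE conjE)
    then have e: "\<And>i. i < n \<Longrightarrow> e i \<in> l2 M"
        "\<And>i j. i < n \<Longrightarrow> j < n \<Longrightarrow> l2_inner M (e i) (e j) = (if i = j then 1 else 0)"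
      and ev: "\<And>i. i < n \<Longrightarrow> AE x in M. l2_adjoint M N F (F (e i)) x = ev i * e i x"
        "\<And>i. i < n \<Longrightarrow> \<sigma> \<le> sqrt (ev i)"
      by simp_all
    \<comment> \<open>The unknowns are the \<open>n\<close> coefficients of the combination; the
      equations state orthogonality to the members of \<open>S\<close>.\<close>
    have "card S < card {..<n}" using S by simp
    then obtain c where c: "\<exists>i\<in>{..<n}. c i \<noteq> 0"
        "\<And>a. a \<in> S \<Longrightarrow> (\<Sum>i<n. c i * l2_inner M (e i) a) = 0"
      by (rule homogeneous_system_solution[OF S(1) finite_lessThan,
            where a = "\<lambda>a i. l2_inner M (e i) a"]) auto
    define f where "f = (\<lambda>x. \<Sum>i<n. c i * e i x)"
    have f: "f \<in> l2 M"
      unfolding f_def using e(1) by (intro l2_sum l2_cmult) auto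
    have f_e: "l2_inner M f (e j) = c j" if "j < n" for j
      unfolding f_def using e that
      by (subst l2_inner_sum_left) (auto simp: if_distrib[of "\<lambda>z. _ * z"] cong: if_cong)
    define s where "s = (\<Sum>i<n. (c i)\<^sup>2)"
    have s: "s > 0"
      unfolding s_def using c(1) by (auto intro!: sum_pos2)
    have f_sq: "(LINT x|M. (f x)\<^sup>2) = s"
    proof -
      have "(LINT x|M. (f x)\<^sup>2) = l2_inner M (\<lambda>x. \<Sum>i<n. c i * e i x) f"
        by (simp add: l2_inner_def f_def power2_eq_square)
      also have "\<dots> = (\<Sum>i<n. c i * l2_inner M (e i) f)"
        using e(1) f by (intro l2_inner_sum_left) auto
      also have "\<dots> = s"
        using f_e by (simp add: s_def l2_inner_def mult.commute power2_eq_square)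
      finally show ?thesis .
    qed
    have G_f: "G f t = (\<Sum>i<n. c i * G (e i) t)" if "t \<in> space N" for t
    proof -
      have "G f t = (LINT x|M. (\<Sum>i<n. c i * (e i x * K x t)))"
        by (simp add: G_def integral_operator_def f_def sum_distrib_right mult.assoc)
      also have "\<dots> = (\<Sum>i<n. c i * G (e i) t)"
        using e(1) that mult_K_integrable
        by (subst Bochner_Integration.integral_sum) (auto simp: G_def integral_operator_def)
      finally show ?thesis .
    qed
    \<comment> \<open>The eigenvalue equation enters here: moving \<open>F\<close> to the other side
      as its adjoint turns the inner product into \<open>ev j\<close> times that of \<open>f\<close>
      and \<open>e j\<close>.\<close>
    have G_e: "l2_inner N (G (e j)) (G f) = c j * ev j" if j: "j < n" for j
    proof -
      have "l2_inner N (G (e j)) (G f) = l2_inner N (F (e j)) (F f)"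
        unfolding F_inner[OF e(1)[OF j] F_l2[OF f]]
        using F_inner[OF f, of "G (e j)"] integral_operator_l2[OF e(1)[OF j]]
        by (simp add: l2_inner_def mult.commute G_def)
      also have "\<dots> = l2_inner N (F f) (F (e j))"
        by (simp add: l2_inner_def mult.commute)
      also have "\<dots> = l2_inner M f (l2_adjoint M N F (F (e j)))"
        by (rule adjoint(1)[OF F_l2[OF e(1)[OF j]] f])
      also have "\<dots> = (LINT x|M. ev j * (f x * e j x))"
        unfolding l2_inner_def
        using ev(1)[OF j] adjoint(2)[OF F_l2[OF e(1)[OF j]] f] f e(1)[OF j]
        by (intro integral_cong_AE) (auto simp: l2_def)
      also have "\<dots> = c j * ev j"
        using f_e[OF j] by (simp add: l2_inner_def)
      finally show ?thesis .
    qed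
    have "(LINT t|N. (G f t)\<^sup>2) = l2_inner N (\<lambda>t. \<Sum>i<n. c i * G (e i) t) (G f)"
      unfolding l2_inner_def
      by (intro Bochner_Integration.integral_cong) (auto simp: G_f power2_eq_square)
    also have "\<dots> = (\<Sum>i<n. c i * l2_inner N (G (e i)) (G f))"
      using e(1) f integral_operator_l2 by (intro l2_inner_sum_left) (auto simp: G_def)
    also have "\<dots> = (\<Sum>i<n. (c i)\<^sup>2 * ev i)"
      using G_e by (simp add: power2_eq_square mult.assoc)
    finally have G_sq: "(LINT t|N. (G f t)\<^sup>2) = (\<Sum>i<n. (c i)\<^sup>2 * ev i)" .
    have "\<sigma>\<^sup>2 * s \<le> (\<Sum>i<n. (c i)\<^sup>2 * ev i)"
      unfolding s_def sum_distrib_left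
    proof (rule sum_mono)
      fix i assume "i \<in> {..<n}"
      then have "\<sigma> \<le> sqrt (ev i)" using ev(2) by simp
      \<comment> \<open>Here \<open>sqrt\<close> of a negative real is negative, so
        \<open>0 \<le> \<sigma>\<close> forces \<open>ev i \<ge> 0\<close> and squaring is
        legitimate.\<close>
      then have "\<sigma>\<^sup>2 \<le> ev i"
        using \<sigma>(1) by (metis order_trans power_mono real_sqrt_ge_0_iff real_sqrt_pow2)
      then show "\<sigma>\<^sup>2 * (c i)\<^sup>2 \<le> (c i)\<^sup>2 * ev i"
        by (metis mult.commute mult_left_mono zero_le_power2)
    qed
    moreover have "(LINT t|N. (G f t)\<^sup>2) \<le> \<epsilon>\<^sup>2 * (m * s) * \<beta>"
    proof -
      have G_le: "(G f t)\<^sup>2 \<le> \<epsilon>\<^sup>2 * (m * s) * (b t)\<^sup>2" if t: "t \<in> space N" for t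
      proof -
        obtain g where g: "g \<in> lspan S" "\<And>x. x \<in> space M \<Longrightarrow> \<bar>K x t - g x\<bar> \<le> \<epsilon> * b t"
          using approx[OF t] by blast
        have "(LINT x|M. f x * a x) = 0" if "a \<in> S" for a
          using c(2)[OF that] l2_inner_sum_left[of "{..<n}" e M a c] e(1) S_l2[OF that]
          by (auto simp: l2_inner_def f_def)
        then have fg: "integrable M (\<lambda>x. f x * g x)" "(LINT x|M. f x * g x) = 0"
          using lspan_integrable_mult[OF g(1), of M f] l2_mult_integrable[OF f] S_l2 by auto
        have K: "integrable M (\<lambda>x. f x * K x t)"
          by (rule mult_K_integrable[OF f t])
        have diff: "integrable M (\<lambda>x. f x * (K x t - g x))"
          using fg K by (simp add: right_diff_distrib)
        \<comment> \<open>Subtracting \<open>g\<close> from the kernel changes nothing, as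
          \<open>g\<close> integrates to zero against \<open>f\<close>.\<close>
        have "G f t = (LINT x|M. f x * (K x t - g x))"
          using fg K by (simp add: G_def integral_operator_def right_diff_distrib)
        also have "\<bar>\<dots>\<bar> \<le> (LINT x|M. \<bar>f x * (K x t - g x)\<bar>)"
          by (rule integral_abs_bound)
        also have "\<dots> \<le> (LINT x|M. \<bar>f x\<bar> * (\<epsilon> * b t))"
        proof (rule integral_mono)
          fix x assume "x \<in> space M"
          then show "\<bar>f x * (K x t - g x)\<bar> \<le> \<bar>f x\<bar> * (\<epsilon> * b t)"
            using g(2) by (simp add: abs_mult mult_left_mono)
        qed (use integrable_abs[OF diff] M.l2_integrable[OF f] in auto)
        finally have "\<bar>G f t\<bar> \<le> (LINT x|M. \<bar>f x\<bar>) * (\<epsilon> * b t)" by simp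
        then have "(G f t)\<^sup>2 \<le> ((LINT x|M. \<bar>f x\<bar>) * (\<epsilon> * b t))\<^sup>2"
          by (metis abs_ge_zero power2_abs power_mono)
        also have "\<dots> = (LINT x|M. \<bar>f x\<bar>)\<^sup>2 * (\<epsilon> * b t)\<^sup>2"
          by (rule power_mult_distrib)
        also have "\<dots> \<le> (m * s) * (\<epsilon> * b t)\<^sup>2"
          using M.l2_abs_integral_le[OF f] by (intro mult_right_mono) (auto simp: f_sq m_def)
        finally show ?thesis by (simp add: power_mult_distrib mult_ac)
      qed
      have "(LINT t|N. (G f t)\<^sup>2) \<le> (LINT t|N. \<epsilon>\<^sup>2 * (m * s) * (b t)\<^sup>2)"
        using G_le integral_operator_l2[OF f] b_l2
        by (intro integral_mono) (auto simp: G_def l2_square_integrable)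
      then show ?thesis by (simp add: \<beta>_def)
    qed
    ultimately have "\<sigma>\<^sup>2 * s \<le> \<epsilon>\<^sup>2 * (m * \<beta>) * s"
      using G_sq by (simp add: mult_ac)
    then have "\<sigma>\<^sup>2 \<le> \<epsilon>\<^sup>2 * (m * \<beta>)"
      using s by simp
    also have "\<dots> = (\<epsilon> * sqrt (m * \<beta>))\<^sup>2"
      using m \<beta> by (simp add: power_mult_distrib)
    finally have "\<sigma>\<^sup>2 \<le> (\<epsilon> * sqrt (m * \<beta>))\<^sup>2" .
    then show ?thesis
      by (rule power2_le_imp_le) (use \<open>\<epsilon> \<ge> 0\<close> m \<beta> in simp)
  qed
  \<comment> \<open>The 0 inserted in \<open>singular_value\<close> makes the set nonempty and must
    itself obey the bound.\<close>
  have "0 \<le> \<epsilon> * sqrt (m * \<beta>)" using \<open>\<epsilon> \<ge> 0\<close> m \<beta> by simp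
  then have "singular_value M N F n \<le> \<epsilon> * sqrt (m * \<beta>)"
    unfolding singular_value_def using bound by (intro cSup_least) auto
  then show ?thesis by (simp add: m_def \<beta>_def)
qed

end


section \<open>Weak derivatives on an interval\<close>

lemma id_measurable_lebesgue_on [measurable]: "(\<lambda>x. x) \<in> borel_measurable (lebesgue_on S)"
  using id_borel_measurable_lebesgue_on[of S] by (simp add: id_def)

lemma smooth_real_measurable:
  assumes "smooth_real f"
  shows "f \<in> borel_measurable (lebesgue_on S)"
  using measurable_compose[OF id_measurable_lebesgue_on
    borel_measurable_continuous_onI[OF smooth_real_continuous_on[OF assms]]] .

lemma smooth_real_bounded:
  assumes "smooth_real f"
  obtains B where "\<And>t. t \<in> {a..b} \<Longrightarrow> \<bar>f t\<bar> \<le> B"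
proof -
  have "bounded (f ` {a..b})"
    by (intro compact_imp_bounded compact_continuous_image smooth_real_continuous_on assms) auto
  then obtain B where "\<forall>y\<in>f ` {a..b}. norm y \<le> B"
    unfolding bounded_iff by blast
  then show ?thesis by (intro that[of B]) simp
qed

lemma integrable_mult_bounded:
  fixes w \<phi> :: "_ \<Rightarrow> real"
  assumes "integrable N w" "\<phi> \<in> borel_measurable N" "\<And>x. x \<in> space N \<Longrightarrow> \<bar>\<phi> x\<bar> \<le> B"
  shows "integrable N (\<lambda>x. w x * \<phi> x)"
proof (rule Bochner_Integration.integrable_bound)
  show "integrable N (\<lambda>x. B * \<bar>w x\<bar>)" using assms(1) by simp
  show "(\<lambda>x. w x * \<phi> x) \<in> borel_measurable N" using assms by simp
  show "AE x in N. norm (w x * \<phi> x) \<le> norm (B * \<bar>w x\<bar>)"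
  proof (rule AE_I2)
    fix x assume "x \<in> space N"
    then have "\<bar>\<phi> x\<bar> \<le> \<bar>B\<bar>" using assms(3) by fastforce
    then show "norm (w x * \<phi> x) \<le> norm (B * \<bar>w x\<bar>)"
      by (simp add: abs_mult mult.commute[of "\<bar>w x\<bar>"] mult_right_mono)
  qed
qed

lemma integrable_if:
  fixes v :: "real \<Rightarrow> real"
  assumes "integrable (lebesgue_on I) v" "Measurable.pred borel P"
  shows "integrable (lebesgue_on I) (\<lambda>x. if P x then v x else 0)"
proof -
  have [measurable]: "Measurable.pred (lebesgue_on I) P"
    using measurable_compose[OF id_measurable_lebesgue_on assms(2)] .
  have "integrable (lebesgue_on I) (\<lambda>x. v x * (if P x then 1 else 0))"
    by (rule integrable_mult_bounded[OF assms(1), where B = 1]) auto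
  then show ?thesis by (rule Bochner_Integration.integrable_cong[THEN iffD1, rotated 2]) auto
qed

text \<open>A bridge from Lebesgue integrals with a cut-off integrand to gauge integrals over closed
  intervals. The predicate covers open and half-open slices alike, because the endpoints are
  negligible.\<close>

lemma lebesgue_on_integral_slice:
  fixes v :: "real \<Rightarrow> real"
  assumes v: "integrable (lebesgue_on I) v" and I: "I \<in> sets lebesgue"
    and P: "Measurable.pred borel P" "\<And>x. s < x \<Longrightarrow> x < t \<Longrightarrow> P x" "\<And>x. P x \<Longrightarrow> x \<in> {s..t}"
  shows "(LINT x|lebesgue_on I. (if P x then v x else 0)) = integral {s..t} (\<lambda>x. if x \<in> I then v x else 0)"
proof -
  let ?v = "\<lambda>x. if x \<in> I then v x else 0"
  have "(LINT x|lebesgue_on I. (if P x then v x else 0)) = integral I (\<lambda>x. if P x then v x else 0)"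
    by (intro lebesgue_integral_eq_integral integrable_if v P(1) I)
  also have "\<dots> = integral UNIV (\<lambda>x. if x \<in> I then if P x then v x else 0 else 0)"
    by (rule Henstock_Kurzweil_Integration.integral_restrict_UNIV[symmetric])
  also have "\<dots> = integral UNIV (\<lambda>x. if x \<in> Collect P then ?v x else 0)"
    by (intro arg_cong[of _ _ "integral UNIV"]) auto
  also have "\<dots> = integral (Collect P) ?v"
    by (rule Henstock_Kurzweil_Integration.integral_restrict_UNIV)
  also have "\<dots> = integral {s..t} ?v"
  proof (rule integral_spike_set)
    have "{x \<in> Collect P - {s..t}. ?v x \<noteq> 0} \<subseteq> {s, t}"
      "{x \<in> {s..t} - Collect P. ?v x \<noteq> 0} \<subseteq> {s, t}"
      using P(2,3) by force+
    then show "negligible {x \<in> Collect P - {s..t}. ?v x \<noteq> 0}"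
      "negligible {x \<in> {s..t} - Collect P. ?v x \<noteq> 0}"
      using negligible_subset[of "{s, t}"] by auto
  qed
  finally show ?thesis .
qed

text \<open>The cut-off sits in the integrand, so the function makes sense for every real
  \<open>t\<close> and is constant on either side of the interval. Increments across an endpoint
  need no special treatment.\<close>

definition primitive :: "real \<Rightarrow> (real \<Rightarrow> real) \<Rightarrow> real \<Rightarrow> real" where
  "primitive T v t = (LINT x|lebesgue_on {0<..<T}. (if x < t then v x else 0))"

section \<open>Absolutely continuous functions: differentiation and integration by parts\<close>

context
  fixes T :: real and v :: "real \<Rightarrow> real"
  assumes v: "integrable (lebesgue_on {0<..<T}) v"
begin

lemma primitive_diff:
  assumes "s \<le> t"
  shows "primitive T v t - primitive T v s = (LINT x|lebesgue_on {0<..<T}. (if s \<le> x \<and> x < t then v x else 0))"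
proof -
  have "primitive T v t - primitive T v s = (LINT x|lebesgue_on {0<..<T}.
      (if x < t then v x else 0) - (if x < s then v x else 0))"
    unfolding primitive_def
    by (intro Bochner_Integration.integral_diff[symmetric] integrable_if v) auto
  also have "\<dots> = (LINT x|lebesgue_on {0<..<T}. (if s \<le> x \<and> x < t then v x else 0))"
    using assms by (intro Bochner_Integration.integral_cong) auto
  finally show ?thesis .
qed

lemma primitive_diff_integral:
  "s \<le> t \<Longrightarrow> primitive T v t - primitive T v s = integral {s..t} (\<lambda>x. if x \<in> {0<..<T} then v x else 0)"
  by (simp only: primitive_diff, rule lebesgue_on_integral_slice[OF v]) auto

lemma primitive_measurable [measurable]: "primitive T v \<in> borel_measurable (lebesgue_on {0<..<T})"
proof -
  interpret finite_measure "lebesgue_on {0<..<T}"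
    by (rule finite_measure_lebesgue_on) auto
  have [measurable]: "v \<in> borel_measurable (lebesgue_on {0<..<T})" using v by simp
  have "(\<lambda>(t, x). if x < t then v x else 0) \<in> borel_measurable (lebesgue_on {0<..<T} \<Otimes>\<^sub>M lebesgue_on {0<..<T})"
    unfolding split_beta by measurable
  then show ?thesis
    unfolding primitive_def[abs_def] by (rule borel_measurable_lebesgue_integral)
qed

lemma primitive_bounded: "\<bar>primitive T v t\<bar> \<le> (LINT x|lebesgue_on {0<..<T}. \<bar>v x\<bar>)"
proof -
  have i: "integrable (lebesgue_on {0<..<T}) (\<lambda>x. if x < t then v x else 0)"
    by (intro integrable_if v) auto
  have "\<bar>primitive T v t\<bar> \<le> (LINT x|lebesgue_on {0<..<T}. \<bar>(if x < t then v x else 0)\<bar>)"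
    unfolding primitive_def by (rule integral_abs_bound)
  also have "\<dots> \<le> (LINT x|lebesgue_on {0<..<T}. \<bar>v x\<bar>)"
    by (intro integral_mono integrable_abs i v) auto
  finally show ?thesis .
qed

text \<open>The library differentiates indefinite integrals from the right; the derivative from the left
  comes from the reflected function.\<close>

lemma AE_primitive_deriv:
  "AE t in lebesgue_on {0<..<T}. (primitive T v has_real_derivative v t) (at t)"
proof -
  \<comment> \<open>After extension by zero, integrals over intervals that leave the domain still
    equal increments of the primitive.\<close>
  define w where "w = (\<lambda>x. if x \<in> {0<..<T} then v x else 0)"
  have "integrable lebesgue w"
    unfolding w_def using v by (subst Lebesgue_Measure.integrable_restrict_UNIV) auto
  then have w: "w integrable_on {a..b}" for a b
    by (metis integrable_on_lebesgue integrable_on_subinterval subset_UNIV interval_cbox)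
  then have w': "(\<lambda>x. w (- x)) integrable_on {a..b}" for a b
    using Henstock_Kurzweil_Integration.integrable_reflect_real[of w "- a" "- b"] w by simp
  obtain N1 where N1: "negligible N1" "\<And>x e. x \<notin> N1 \<Longrightarrow> 0 < e \<Longrightarrow>
      \<exists>d>0. \<forall>h. 0 < h \<and> h < d \<longrightarrow> norm (integral (cbox x (x + h *\<^sub>R One)) w /\<^sub>R h ^ DIM(real) - w x) < e"
    using integrable_ccontinuous_explicit[where f = w] w by (metis interval_cbox)
  obtain N2 where N2: "negligible N2" "\<And>x e. x \<notin> N2 \<Longrightarrow> 0 < e \<Longrightarrow>
      \<exists>d>0. \<forall>h. 0 < h \<and> h < d \<longrightarrow>
        norm (integral (cbox x (x + h *\<^sub>R One)) (\<lambda>x. w (- x)) /\<^sub>R h ^ DIM(real) - w (- x)) < e"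
    using integrable_ccontinuous_explicit[where f = "\<lambda>x. w (- x)"] w' by (metis interval_cbox)
  have "negligible (uminus ` N2)"
    using N2(1)
    by (intro negligible_differentiable_image_negligible linear_imp_differentiable_on linear_uminus) auto
  then have "N1 \<union> uminus ` N2 \<in> null_sets lebesgue"
    using N1(1) negligible_Un negligible_iff_null_sets by blast
  then have "AE t in lebesgue. t \<notin> N1 \<union> uminus ` N2"
    by (rule AE_not_in)
  then have "AE t in lebesgue. t \<in> {0<..<T} \<longrightarrow> (primitive T v has_real_derivative v t) (at t)"
  proof (rule AE_mp, intro AE_I2 impI)
    fix t assume t: "t \<notin> N1 \<union> uminus ` N2" "t \<in> {0<..<T}"
    then have t': "t \<notin> N1" "- t \<notin> N2" by force+
    have right: "primitive T v (t + h) - primitive T v t = integral {t..t + h} w" if "h > 0" for h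
      using primitive_diff_integral[of t "t + h"] that by (simp add: w_def)
    have left: "primitive T v (t - h) - primitive T v t = - integral {- t..- t + h} (\<lambda>x. w (- x))"
      if "h > 0" for h
      using primitive_diff_integral[of "t - h" t] that Henstock_Kurzweil_Integration.integral_reflect_real[of t "t - h" w]
      by (simp add: w_def)
    show "(primitive T v has_real_derivative v t) (at t)"
      unfolding DERIV_def
    proof (rule LIM_I)
      fix e :: real assume e: "e > 0"
      obtain d1 where d1: "d1 > 0" "\<And>h. 0 < h \<Longrightarrow> h < d1 \<Longrightarrow> \<bar>integral {t..t + h} w / h - w t\<bar> < e"
        using N1(2)[OF t'(1) e] by (auto simp: divide_inverse_commute)
      obtain d2 where d2: "d2 > 0"
        "\<And>h. 0 < h \<Longrightarrow> h < d2 \<Longrightarrow> \<bar>integral {- t..- t + h} (\<lambda>x. w (- x)) / h - w t\<bar> < e"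
        using N2(2)[OF t'(2) e] by (auto simp: divide_inverse_commute)
      have "norm ((primitive T v (t + h) - primitive T v t) / h - v t) < e"
        if h: "h \<noteq> 0" "norm (h - 0) < min d1 d2" for h
      proof (cases "h > 0")
        case True
        then show ?thesis
          using d1(2)[of h] h t(2) right[of h] by (simp add: w_def)
      next
        case False
        then show ?thesis
          using d2(2)[of "- h"] h t(2) left[of "- h"] by (simp add: w_def)
      qed
      then show "\<exists>d>0. \<forall>h. h \<noteq> 0 \<and> norm (h - 0) < d \<longrightarrow>
          norm ((primitive T v (t + h) - primitive T v t) / h - v t) < e"
        using d1(1) d2(1) by (intro exI[of _ "min d1 d2"]) auto
    qed
  qed
  then show ?thesis by (subst AE_restrict_space_iff) auto
qed

text \<open>Fubini replaces the product rule, as the primitive is differentiable only almost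
  everywhere: after exchanging the integrals, the inner one is that of \<open>deriv \<phi>\<close>
  from \<open>s\<close> to \<open>T\<close>. It equals \<open>- \<phi> s\<close>, since the support
  of \<open>\<phi>\<close> stays away from \<open>T\<close>.\<close>

lemma primitive_by_parts:
  assumes "\<phi> \<in> test_functions {0<..<T}"
  shows "(LINT t|lebesgue_on {0<..<T}. primitive T v t * deriv \<phi> t) = - (LINT t|lebesgue_on {0<..<T}. v t * \<phi> t)"
proof -
  let ?N = "lebesgue_on {0<..<T}"
  interpret N: finite_measure ?N
    by (rule finite_measure_lebesgue_on) auto
  interpret P: pair_sigma_finite ?N ?N ..
  have \<phi>: "smooth_real \<phi>" and "\<exists>K. compact K \<and> K \<subseteq> {0<..<T} \<and> (\<forall>x. x \<notin> K \<longrightarrow> \<phi> x = 0)"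
    using assms by (auto simp: test_functions_smooth)
  then have \<phi>T: "\<phi> T = 0" by fastforce
  note \<phi>' = smooth_real_deriv[OF \<phi>]
  have [measurable]: "v \<in> borel_measurable ?N" using v by simp
  have [measurable]: "deriv \<phi> \<in> borel_measurable ?N"
    by (rule smooth_real_measurable[OF \<phi>'(1)])
  obtain B where B: "\<And>t. t \<in> {0..T} \<Longrightarrow> \<bar>deriv \<phi> t\<bar> \<le> B"
    using smooth_real_bounded[OF \<phi>'(1), where a = 0 and b = T] by blast
  have int: "integrable (?N \<Otimes>\<^sub>M ?N) (\<lambda>(s, t). (if s < t then v s else 0) * deriv \<phi> t)"
  proof (rule Bochner_Integration.integrable_bound)
    show "integrable (?N \<Otimes>\<^sub>M ?N) (\<lambda>z. \<bar>v (fst z)\<bar> * B)"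
      by (intro P.integrable_tensor_product[of "\<lambda>s. \<bar>v s\<bar>" "\<lambda>_. B"] integrable_abs v) simp
    show "(\<lambda>(s, t). (if s < t then v s else 0) * deriv \<phi> t) \<in> borel_measurable (?N \<Otimes>\<^sub>M ?N)"
      unfolding split_beta by measurable
    have "\<bar>(if s < t then v s else 0) * deriv \<phi> t\<bar> \<le> \<bar>\<bar>v s\<bar> * B\<bar>" if "t \<in> {0<..<T}" for s t
      using B[of t] that by (auto simp: abs_mult intro!: mult_mono)
    then show "AE z in ?N \<Otimes>\<^sub>M ?N. norm (case z of (s, t) \<Rightarrow> (if s < t then v s else 0) * deriv \<phi> t)
        \<le> norm (\<bar>v (fst z)\<bar> * B)"
      by (intro AE_I2) (auto simp: space_pair_measure)
  qed
  have inner: "(LINT t|?N. (if s < t then deriv \<phi> t else 0)) = - \<phi> s" if s: "s \<in> {0<..<T}" for s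
  proof -
    have "integrable ?N (deriv \<phi>)"
      using B by (intro N.integrable_const_bound[where B = B] AE_I2) auto
    \<comment> \<open>The conjunct \<open>t < T\<close> always holds on the domain; it makes the
      slice bounded, as \<open>lebesgue_on_integral_slice\<close> demands.\<close>
    then have "(LINT t|?N. (if s < t \<and> t < T then deriv \<phi> t else 0))
        = integral {s..T} (\<lambda>t. if t \<in> {0<..<T} then deriv \<phi> t else 0)"
      by (rule lebesgue_on_integral_slice) auto
    also have "\<dots> = integral {s..T} (deriv \<phi>)"
      using s by (intro integral_spike[of "{T}"]) auto
    also have "\<dots> = \<phi> T - \<phi> s"
      using s \<phi>'(2)
      by (intro integral_unique fundamental_theorem_of_calculus)
         (auto simp: has_real_derivative_iff_has_vector_derivative[symmetric]
           intro: has_field_derivative_at_within)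
    finally have "(LINT t|?N. (if s < t \<and> t < T then deriv \<phi> t else 0)) = - \<phi> s"
      by (simp add: \<phi>T)
    moreover have "(LINT t|?N. (if s < t \<and> t < T then deriv \<phi> t else 0))
        = (LINT t|?N. (if s < t then deriv \<phi> t else 0))"
      by (intro Bochner_Integration.integral_cong) auto
    ultimately show ?thesis by simp
  qed
  have "(LINT t|?N. primitive T v t * deriv \<phi> t)
      = (LINT t|?N. (LINT s|?N. (if s < t then v s else 0) * deriv \<phi> t))"
    by (simp add: primitive_def)
  also have "\<dots> = (LINT s|?N. (LINT t|?N. (if s < t then v s else 0) * deriv \<phi> t))"
    using P.Fubini_integral[of "\<lambda>s t. (if s < t then v s else 0) * deriv \<phi> t"] int by simp
  also have "\<dots> = (LINT s|?N. (LINT t|?N. v s * (if s < t then deriv \<phi> t else 0)))"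
    by (intro Bochner_Integration.integral_cong) auto
  also have "\<dots> = (LINT s|?N. v s * - \<phi> s)"
    using inner by (intro Bochner_Integration.integral_cong) auto
  finally show ?thesis by simp
qed

end

text \<open>An antiderivative vanishing to the left of the support of \<open>f\<close> is constant
  to its right, and the constant is the integral of \<open>f\<close>. Zero mean is thus exactly what
  makes it compactly supported.\<close>

lemma test_function_antiderivative:
  assumes f: "smooth_real f" "\<And>x. x \<notin> {a..b} \<Longrightarrow> f x = 0"
    and ab: "0 < a" "a \<le> b" "b < T"
    and int: "(LINT x|lebesgue_on {0<..<T}. f x) = 0"
  obtains \<phi> where "\<phi> \<in> test_functions {0<..<T}" "deriv \<phi> = f"
proof -
  have cont: "isCont f x" for x
    using smooth_real_deriv(2)[OF f(1)] DERIV_isCont by blast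
  obtain F where F: "\<And>x. (F has_field_derivative f x) (at x)"
    using einterval_antiderivative[of "- \<infinity>" \<infinity> f] cont
    by (auto simp: has_real_derivative_iff_has_vector_derivative)
  define \<phi> where "\<phi> = (\<lambda>x. F x - F 0)"
  have \<phi>: "(\<phi> has_field_derivative f x) (at x)" for x
    unfolding \<phi>_def using F by (auto intro!: derivative_eq_intros)
  have left: "\<phi> x = 0" if "x < a" for x
  proof -
    have "\<exists>c. \<forall>x\<in>{..<a}. \<phi> x = c"
      using \<phi> f(2) by (intro has_field_derivative_zero_constant)
        (auto, metis atLeastAtMost_iff has_field_derivative_at_within not_le)
    moreover have "\<phi> 0 = 0" by (simp add: \<phi>_def)
    ultimately show ?thesis using that ab by auto
  qed
  have right: "\<phi> x = 0" if "x > b" for x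
  proof -
    have "\<exists>c. \<forall>x\<in>{b<..}. \<phi> x = c"
      using \<phi> f(2) by (intro has_field_derivative_zero_constant)
        (auto, metis atLeastAtMost_iff has_field_derivative_at_within not_le)
    moreover have "\<phi> T = 0"
    proof -
      interpret N: finite_measure "lebesgue_on {0<..<T}"
        by (rule finite_measure_lebesgue_on) auto
      obtain B where "\<And>t. t \<in> {0..T} \<Longrightarrow> \<bar>f t\<bar> \<le> B"
        using smooth_real_bounded[OF f(1), where a = 0 and b = T] by blast
      then have "integrable (lebesgue_on {0<..<T}) f"
        using smooth_real_measurable[OF f(1)]
        by (intro N.integrable_const_bound[where B = B] AE_I2) auto
      then have "(LINT x|lebesgue_on {0<..<T}. f x) = integral {0<..<T} f"
        by (rule lebesgue_integral_eq_integral) auto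
      also have "\<dots> = integral {0..T} f"
        by (simp add: integral_open_interval_real)
      also have "\<dots> = \<phi> T - \<phi> 0"
        using \<phi> ab
        by (intro integral_unique fundamental_theorem_of_calculus)
           (auto simp: has_real_derivative_iff_has_vector_derivative[symmetric]
             intro: has_field_derivative_at_within)
      finally show ?thesis using int by (simp add: \<phi>_def)
    qed
    ultimately show ?thesis using that ab by auto
  qed
  show ?thesis
  proof (rule that)
    have "smooth_real \<phi>" by (rule smooth_real_antiderivative[OF \<phi> f(1)])
    moreover have "compact {a..b} \<and> {a..b} \<subseteq> {0<..<T} \<and> (\<forall>x. x \<notin> {a..b} \<longrightarrow> \<phi> x = 0)"
      using left right ab by auto
    ultimately show "\<phi> \<in> test_functions {0<..<T}"
      unfolding test_functions_smooth by blast
    show "deriv \<phi> = f"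
      using DERIV_imp_deriv[OF \<phi>] by auto
  qed
qed

text \<open>A bump minus a suitable multiple of one fixed bump \<open>\<psi>\<close> has mean zero
  and is the derivative of a test function. Hence \<open>w - c\<close>, with \<open>c\<close> the
  \<open>\<psi>\<close>-weighted mean of \<open>w\<close>, integrates to zero against every bump
  and, in the limit of steep bumps, over every subinterval. Its primitive is constant inside the
  domain and its almost everywhere derivative zero.\<close>

lemma du_bois_reymond:
  assumes w: "integrable (lebesgue_on {0<..<T}) w" and "T > 0"
    and test: "\<And>\<phi>. \<phi> \<in> test_functions {0<..<T} \<Longrightarrow>
      (LINT t|lebesgue_on {0<..<T}. w t * deriv \<phi> t) = 0"
  obtains c where "AE t in lebesgue_on {0<..<T}. w t = c"
proof -
  let ?N = "lebesgue_on {0<..<T}"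
  interpret N: finite_measure ?N
    by (rule finite_measure_lebesgue_on) auto
  have [measurable]: "bump a b n \<in> borel_measurable ?N" for a b n
    by (intro smooth_real_measurable smooth_bump)
  have bump_le: "\<bar>bump a b n t\<bar> \<le> 1" for a b n t
    using bump_bounds[of a b n t] by simp
  have int_bump: "integrable ?N (bump a b n)" for a b n
    using bump_le by (intro N.integrable_const_bound[where B = 1] AE_I2) auto
  define \<psi> where "\<psi> = bump (T / 4) (3 * T / 4) 1"
  define k where "k = (LINT t|?N. \<psi> t)"
  \<comment> \<open>A vanishing integral of the nonnegative \<open>\<psi>\<close> would make it zero
    almost everywhere, by continuity also at \<open>T / 2\<close>, where it is positive.\<close>
  have "k \<noteq> 0"
  proof
    assume "k = 0"
    then have "AE t in ?N. \<psi> t = 0"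
      using integral_nonneg_eq_0_iff_AE[of ?N \<psi>] int_bump bump_bounds by (auto simp: \<psi>_def k_def)
    then have ae: "AE t in lebesgue. t \<in> {0<..<T} \<longrightarrow> t \<in> {t. \<psi> t = 0}"
      by (subst (asm) AE_restrict_space_iff) auto
    have "closed {t. \<psi> t = 0}"
      unfolding \<psi>_def by (intro closed_Collect_eq smooth_real_continuous_on smooth_bump smooth_real_const)
    from mem_closed_if_AE_lebesgue_open[OF _ this ae, of "T / 2"] have "\<psi> (T / 2) = 0"
      using \<open>T > 0\<close> by simp
    moreover have "\<psi> (T / 2) > 0"
      unfolding \<psi>_def using \<open>T > 0\<close> by (intro bump_pos) auto
    ultimately show False by simp
  qed
  define c where "c = (LINT t|?N. w t * \<psi> t) / k"
  define z where "z = (\<lambda>t. w t - c)"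
  have z: "integrable ?N z" unfolding z_def using w by simp
  then have [measurable]: "z \<in> borel_measurable ?N" by simp
  have z_bump: "(LINT t|?N. z t * bump a b n t) = 0" if ab: "0 < a" "a < b" "b < T" for a b n
  proof -
    define e where "e = (LINT t|?N. bump a b n t)"
    define f where "f = (\<lambda>t. bump a b n t - e / k * \<psi> t)"
    have "(LINT t|?N. f t) = 0"
      unfolding f_def using int_bump \<open>k \<noteq> 0\<close> by (simp add: \<psi>_def e_def k_def)
    moreover have "smooth_real f"
      unfolding f_def \<psi>_def by (intro smooth_real_diff_cmult smooth_bump)
    moreover have "f t = 0" if "t \<notin> {min a (T / 4)..max b (3 * T / 4)}" for t
      unfolding f_def \<psi>_def using that by (subst (1 2) bump_eq_0) auto
    ultimately obtain \<phi> where "\<phi> \<in> test_functions {0<..<T}" "deriv \<phi> = f"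
      using ab \<open>T > 0\<close>
      by (elim test_function_antiderivative[of f "min a (T / 4)" "max b (3 * T / 4)" T, rotated -1]) auto
    then have "0 = (LINT t|?N. w t * f t)" using test by metis
    also have "\<dots> = (LINT t|?N. w t * bump a b n t - e / k * (w t * \<psi> t))"
      by (simp add: f_def algebra_simps)
    also have "\<dots> = (LINT t|?N. w t * bump a b n t) - c * e"
      using integrable_mult_bounded[OF w _ bump_le]
      by (subst Bochner_Integration.integral_diff) (auto simp: c_def \<psi>_def)
    finally have "(LINT t|?N. w t * bump a b n t) = c * e" by simp
    then show ?thesis
      unfolding z_def left_diff_distrib using integrable_mult_bounded[OF w _ bump_le] int_bump
      by (subst Bochner_Integration.integral_diff) (auto simp: e_def)
  qed
  have z_slice: "(LINT t|?N. z t * indicator {a<..<b} t) = 0" if "0 < a" "a < b" "b < T" for a b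
  proof -
    have "(\<lambda>n. LINT t|?N. z t * bump a b n t) \<longlonglongrightarrow> (LINT t|?N. z t * indicator {a<..<b} t)"
    proof (rule integral_dominated_convergence[where w = "\<lambda>t. \<bar>z t\<bar>"])
      show "(\<lambda>t. z t * indicator {a<..<b} t) \<in> borel_measurable ?N"
        using measurable_compose[OF id_measurable_lebesgue_on borel_measurable_indicator[of "{a<..<b}" borel]]
        by (intro borel_measurable_times) auto
      show "AE t in ?N. norm (z t * bump a b n t) \<le> \<bar>z t\<bar>" for n
        using bump_le by (auto simp: abs_mult mult_left_le)
    qed (use z in \<open>auto intro!: AE_I2 tendsto_mult bump_tendsto_indicator\<close>)
    then show ?thesis
      using z_bump[OF that] by (simp add: LIMSEQ_const_iff)
  qed
  have const: "primitive T z t = primitive T z s" if "0 < s" "s < t" "t < T" for s t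
  proof -
    have "primitive T z t - primitive T z s = integral {s..t} (\<lambda>x. if x \<in> {0<..<T} then z x else 0)"
      using that by (intro primitive_diff_integral[OF z]) auto
    also have "\<dots> = (LINT x|?N. (if s < x \<and> x < t then z x else 0))"
      by (rule lebesgue_on_integral_slice[OF z, symmetric]) auto
    also have "\<dots> = (LINT x|?N. z x * indicator {s<..<t} x)"
      by (intro Bochner_Integration.integral_cong) (auto simp: indicator_def)
    finally show ?thesis using z_slice[OF that] by simp
  qed
  have "AE t in ?N. w t = c"
    using AE_primitive_deriv[OF z]
  proof (rule lebesgue_on_mono)
    fix t assume t: "(primitive T z has_real_derivative z t) (at t)" "t \<in> {0<..<T}"
    have "(primitive T z has_real_derivative 0) (at t)"
    proof (rule has_field_derivative_transform_within_open[OF DERIV_const])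
      show "primitive T z t = primitive T z x" if "x \<in> {0<..<T}" for x
        using const[of x t] const[of t x] that t(2) by (cases x t rule: linorder_cases) auto
    qed (use t(2) in auto)
    then have "z t = 0" using t(1) DERIV_unique by blast
    then show "w t = c" by (simp add: z_def)
  qed
  then show ?thesis by (rule that)
qed

text \<open>The difference of \<open>f\<close> and the primitive of its first weak derivative has
  weak derivative zero, so it is constant almost everywhere.\<close>

lemma sobolev_representation:
  assumes f: "f \<in> sobolev s {0<..<T}" and "s \<ge> 1" "T > 0"
  obtains c v where "v \<in> l2 (lebesgue_on {0<..<T})"
    "AE t in lebesgue_on {0<..<T}. f t = c + primitive T v t"
proof -
  let ?N = "lebesgue_on {0<..<T}"
  interpret N: finite_measure ?N
    by (rule finite_measure_lebesgue_on) auto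
  have "1 \<le> nat \<lfloor>s\<rfloor>" using \<open>s \<ge> 1\<close> by (simp add: le_nat_iff)
  then obtain v where v: "v \<in> l2 ?N" and weak: "has_weak_deriv {0<..<T} 1 f v" and "f \<in> l2 ?N"
    using f unfolding sobolev_def by blast
  then have int: "integrable ?N v" "integrable ?N f" by (auto intro: N.l2_integrable)
  note prim = primitive_measurable[OF int(1)] primitive_bounded[OF int(1)]
  have V: "integrable ?N (primitive T v)"
    using prim by (intro N.integrable_const_bound) auto
  obtain c where "AE t in ?N. f t - primitive T v t = c"
  proof (rule du_bois_reymond[OF _ \<open>T > 0\<close>])
    show "integrable ?N (\<lambda>t. f t - primitive T v t)" using int V by simp
    fix \<phi> assume \<phi>: "\<phi> \<in> test_functions {0<..<T}"
    then have "smooth_real \<phi>" by (simp add: test_functions_smooth)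
    note \<phi>' = smooth_real_deriv(1)[OF this]
    obtain B where "\<And>t. t \<in> {0..T} \<Longrightarrow> \<bar>deriv \<phi> t\<bar> \<le> B"
      using smooth_real_bounded[OF \<phi>', where a = 0 and b = T] by blast
    then have B: "\<And>t. t \<in> space ?N \<Longrightarrow> \<bar>deriv \<phi> t\<bar> \<le> B" by simp
    note m = smooth_real_measurable[OF \<phi>']
    note i = integrable_mult_bounded[OF _ m B]
    have "(LINT t|?N. (f t - primitive T v t) * deriv \<phi> t)
        = (LINT t|?N. f t * deriv \<phi> t) - (LINT t|?N. primitive T v t * deriv \<phi> t)"
      unfolding left_diff_distrib by (intro Bochner_Integration.integral_diff i int V)
    also have "\<dots> = 0"
      using weak \<phi> primitive_by_parts[OF int(1) \<phi>] by (simp add: has_weak_deriv_def)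
    finally show "(LINT t|?N. (f t - primitive T v t) * deriv \<phi> t) = 0" .
  qed
  then have "AE t in ?N. f t = c + primitive T v t" by (auto simp: algebra_simps)
  then show ?thesis using that v by blast
qed


section \<open>Taylor expansion of the kernel\<close>

primrec fun_power :: "('a \<Rightarrow> real) set \<Rightarrow> nat \<Rightarrow> ('a \<Rightarrow> real) set" where
  "fun_power S 0 = {\<lambda>x. 1}"
| "fun_power S (Suc k) = fun_products S (fun_power S k)"

lemma lspan_power: "f \<in> lspan S \<Longrightarrow> (\<lambda>x. f x ^ k) \<in> lspan (fun_power S k)"
  by (induction k) (auto intro: lspan_base lspan_mult)

lemma finite_fun_power: "finite S \<Longrightarrow> finite (fun_power S k)"
  by (induction k) (auto intro: finite_fun_products)

lemma card_fun_power_le: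
  assumes "finite S"
  shows "card (fun_power S k) \<le> card S ^ k"
proof (induction k)
  case (Suc k)
  have "card (fun_power S (Suc k)) \<le> card S * card (fun_power S k)"
    using assms by (simp add: card_fun_products_le finite_fun_power)
  also have "\<dots> \<le> card S ^ Suc k" using Suc by simp
  finally show ?case .
qed simp

text \<open>Unlike \<open>l2\<close>, this class is closed under products, and on a finite measure
  space it is contained in \<open>l2\<close>.\<close>

definition bounded_measurable :: "'a measure \<Rightarrow> ('a \<Rightarrow> real) set" where
  "bounded_measurable M = {f \<in> borel_measurable M. \<exists>B. \<forall>x\<in>space M. \<bar>f x\<bar> \<le> B}"

lemma bounded_measurableI:
  "f \<in> borel_measurable M \<Longrightarrow> (\<And>x. x \<in> space M \<Longrightarrow> \<bar>f x\<bar> \<le> B) \<Longrightarrow> f \<in> bounded_measurable M"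
  by (auto simp: bounded_measurable_def)

lemma vec_nth_bounded_measurable:
  fixes f :: "'a \<Rightarrow> real ^ 'd"
  assumes [measurable]: "f \<in> borel_measurable M" and "\<And>x. x \<in> space M \<Longrightarrow> norm (f x) \<le> B"
  shows "(\<lambda>x. f x $ i) \<in> bounded_measurable M"
proof (rule bounded_measurableI[where B = B])
  have "(\<lambda>x. f x \<bullet> axis i 1) \<in> borel_measurable M" by measurable
  then show "(\<lambda>x. f x $ i) \<in> borel_measurable M" by (simp add: inner_axis)
  show "\<bar>f x $ i\<bar> \<le> B" if "x \<in> space M" for x
    using component_le_norm_cart[of "f x" i] assms(2)[OF that] by linarith
qed

lemma bounded_measurable_mult:
  assumes "f \<in> bounded_measurable M" "g \<in> bounded_measurable M"
  shows "(\<lambda>x. f x * g x) \<in> bounded_measurable M"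
proof -
  obtain B C where "\<And>x. x \<in> space M \<Longrightarrow> \<bar>f x\<bar> \<le> B" "\<And>x. x \<in> space M \<Longrightarrow> \<bar>g x\<bar> \<le> C"
    using assms unfolding bounded_measurable_def by blast
  then have "\<bar>f x * g x\<bar> \<le> B * C" if "x \<in> space M" for x
    using that unfolding abs_mult by (intro mult_mono) force+
  then show ?thesis
    using assms by (intro bounded_measurableI) (auto simp: bounded_measurable_def)
qed

lemma fun_products_bounded_measurable:
  "S \<subseteq> bounded_measurable M \<Longrightarrow> S' \<subseteq> bounded_measurable M \<Longrightarrow>
    fun_products S S' \<subseteq> bounded_measurable M"
  by (auto simp: fun_products_def intro!: bounded_measurable_mult)

lemma fun_power_bounded_measurable:
  "S \<subseteq> bounded_measurable M \<Longrightarrow> fun_power S k \<subseteq> bounded_measurable M"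
proof (induction k)
  case 0
  show ?case by (auto intro: bounded_measurableI[of _ _ 1])
qed (simp add: fun_products_bounded_measurable)

lemma (in finite_measure) bounded_measurable_l2:
  assumes "f \<in> bounded_measurable M"
  shows "f \<in> l2 M"
proof -
  obtain B where "f \<in> borel_measurable M" "\<And>x. x \<in> space M \<Longrightarrow> \<bar>f x\<bar> \<le> B"
    using assms by (auto simp: bounded_measurable_def)
  then show ?thesis using l2_dominated[OF const_l2] by blast
qed

text \<open>Representatives with bounds valid everywhere: \<open>u\<close> stands for the continuous
  version of h, \<open>v\<close> for its derivative, and \<open>m\<close> for the product of the two
  physical constants. The relation between \<open>u\<close> and \<open>v\<close> enters only when
  \<open>K\<close> is identified with \<open>kernel\<close>.\<close>

locale moving_field = finite_measure M for M :: "'a measure" +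
  fixes T G D m :: real and \<phi> :: "nat \<Rightarrow> real \<Rightarrow> real"
    and g p :: "'a \<Rightarrow> real ^ 'd" and u v :: "real \<Rightarrow> real ^ 'd" and b0 :: "real \<Rightarrow> real"
  assumes T: "T > 0" and m: "m \<ge> 0"
    and \<phi>: "\<And>k w. w \<ge> 0 \<Longrightarrow> (\<phi> k has_field_derivative \<phi> (Suc k) w) (at w)"
    and g_measurable [measurable]: "g \<in> borel_measurable M"
    and p_measurable [measurable]: "p \<in> borel_measurable M"
    and g_bound: "\<And>x. x \<in> space M \<Longrightarrow> norm (g x) \<le> G"
    and p_bound: "\<And>x. x \<in> space M \<Longrightarrow> norm (p x) \<le> G"
    and u_measurable [measurable]: "u \<in> borel_measurable (lebesgue_on {0<..<T})"
    and v_measurable [measurable]: "v \<in> borel_measurable (lebesgue_on {0<..<T})"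
    and u_bound: "\<And>t. t \<in> {0<..<T} \<Longrightarrow> norm (u t) \<le> G"
    and v_bound: "\<And>t. t \<in> {0<..<T} \<Longrightarrow> norm (v t) \<le> b0 t"
    and b0: "b0 \<in> l2 (lebesgue_on {0<..<T})"
    and u_holder: "\<And>s t. s \<in> {0<..<T} \<Longrightarrow> t \<in> {0<..<T} \<Longrightarrow> norm (u t - u s) \<le> D * sqrt \<bar>t - s\<bar>"
begin

definition field :: "'a \<Rightarrow> real \<Rightarrow> real ^ 'd" where
  "field x t = g x - u t"

definition sq :: "'a \<Rightarrow> real \<Rightarrow> real" where
  "sq x t = (norm (field x t))\<^sup>2"

definition K :: "'a \<Rightarrow> real \<Rightarrow> real" where
  "K x t = - m * (\<phi> 0 (sq x t) * (p x \<bullet> v t) + 2 * (\<phi> 1 (sq x t) * ((p x \<bullet> field x t) * (field x t \<bullet> v t))))"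

lemma G_nonneg: "G \<ge> 0"
  using order_trans[OF norm_ge_zero u_bound[of "T / 2"]] T by simp

lemma field_bound: "x \<in> space M \<Longrightarrow> t \<in> {0<..<T} \<Longrightarrow> norm (field x t) \<le> 2 * G"
  using norm_triangle_ineq4[of "g x" "u t"] g_bound[of x] u_bound[of t] by (simp add: field_def)

lemma sq_range: "x \<in> space M \<Longrightarrow> t \<in> {0<..<T} \<Longrightarrow> sq x t \<in> {0..(2 * G)\<^sup>2}"
  using power_mono[OF field_bound, of x t 2] by (simp add: sq_def)

text \<open>The difference of the squared norms of a and b is the inner product of a - b and a + b.
  The first factor is an increment of \<open>u\<close>; the second has norm at most
  \<open>4 * G\<close>.\<close>

lemma sq_holder:
  assumes "x \<in> space M" "s \<in> {0<..<T}" "t \<in> {0<..<T}"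
  shows "\<bar>sq x t - sq x s\<bar> \<le> 4 * G * D * sqrt \<bar>t - s\<bar>"
proof -
  have "sq x t - sq x s = (field x t - field x s) \<bullet> (field x t + field x s)"
    by (simp add: sq_def power2_norm_eq_inner algebra_simps inner_commute)
  also have "\<bar>\<dots>\<bar> \<le> norm (field x t - field x s) * norm (field x t + field x s)"
    by (rule Cauchy_Schwarz_ineq2)
  also have "\<dots> \<le> (D * sqrt \<bar>t - s\<bar>) * (4 * G)"
  proof (rule mult_mono)
    show "norm (field x t - field x s) \<le> D * sqrt \<bar>t - s\<bar>"
      using u_holder[OF assms(2,3)] by (simp add: field_def norm_minus_commute)
    show "norm (field x t + field x s) \<le> 4 * G"
      using norm_triangle_ineq[of "field x t" "field x s"] field_bound[OF assms(1,2)]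
        field_bound[OF assms(1,3)] by linarith
    show "0 \<le> D * sqrt \<bar>t - s\<bar>"
      using u_holder[OF assms(2,3)] norm_ge_zero order_trans by blast
  qed simp
  finally show ?thesis by (simp add: mult_ac)
qed

text \<open>The functions \<open>\<phi> k\<close> are controlled on the half-line only;
  \<open>max 0\<close> extends them continuously and does not affect their values at squared
  norms.\<close>

lemma \<phi>_measurable: "(\<lambda>w. \<phi> k (max 0 w)) \<in> borel_measurable borel"
proof (rule borel_measurable_continuous_onI)
  have "continuous_on {0..} (\<phi> k)"
    using DERIV_isCont[OF \<phi>] by (intro continuous_at_imp_continuous_on) auto
  then show "continuous_on UNIV (\<lambda>w. \<phi> k (max 0 w))"
    by (rule continuous_on_compose2) (auto intro!: continuous_intros)
qed

lemma \<phi>_bounded: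
  obtains B where "\<And>w. w \<in> {0..(2 * G)\<^sup>2} \<Longrightarrow> \<bar>\<phi> k w\<bar> \<le> B"
proof -
  have "continuous_on {0..(2 * G)\<^sup>2} (\<phi> k)"
    using DERIV_isCont[OF \<phi>] by (intro continuous_at_imp_continuous_on) auto
  then have "bounded (\<phi> k ` {0..(2 * G)\<^sup>2})"
    by (intro compact_imp_bounded compact_continuous_image) auto
  then obtain B where "\<forall>y\<in>\<phi> k ` {0..(2 * G)\<^sup>2}. norm y \<le> B"
    unfolding bounded_iff by blast
  then show ?thesis by (intro that[of B]) simp
qed

lemma K_measurable: "(\<lambda>(x, t). K x t) \<in> borel_measurable (M \<Otimes>\<^sub>M lebesgue_on {0<..<T})"
proof -
  note [measurable] = \<phi>_measurable
  have eq: "K = (\<lambda>x t. - m * (\<phi> 0 (max 0 (sq x t)) * (p x \<bullet> v t)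
      + 2 * (\<phi> 1 (max 0 (sq x t)) * ((p x \<bullet> field x t) * (field x t \<bullet> v t)))))"
    by (simp add: K_def sq_def fun_eq_iff)
  show ?thesis
    unfolding eq split_beta sq_def field_def by measurable
qed

text \<open>\<open>w\<close> stands for \<open>\<phi> (sq x t)\<close> or its Taylor remainder, \<open>w'\<close> likewise for \<open>\<phi>'\<close>.\<close>

lemma bilinear_bound:
  assumes "x \<in> space M" "t \<in> {0<..<T}" "\<bar>w\<bar> \<le> B" "\<bar>w'\<bar> \<le> B"
  shows "\<bar>- m * (w * (p x \<bullet> v t) + 2 * (w' * ((p x \<bullet> field x t) * (field x t \<bullet> v t))))\<bar>
    \<le> B * (m * (G + 8 * G ^ 3)) * b0 t"
proof -
  have B: "B \<ge> 0" using assms(3) by linarith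
  have b: "0 \<le> b0 t" using v_bound[OF assms(2)] norm_ge_zero order_trans by blast
  have pv: "\<bar>p x \<bullet> v t\<bar> \<le> G * b0 t"
    using Cauchy_Schwarz_ineq2[of "p x" "v t"]
      mult_mono[OF p_bound[OF assms(1)] v_bound[OF assms(2)] G_nonneg norm_ge_zero] by linarith
  have pf: "\<bar>p x \<bullet> field x t\<bar> \<le> G * (2 * G)"
    using Cauchy_Schwarz_ineq2[of "p x" "field x t"]
      mult_mono[OF p_bound[OF assms(1)] field_bound[OF assms(1,2)] G_nonneg norm_ge_zero] by linarith
  have fv: "\<bar>field x t \<bullet> v t\<bar> \<le> 2 * G * b0 t"
    using Cauchy_Schwarz_ineq2[of "field x t" "v t"] G_nonneg
      mult_mono[OF field_bound[OF assms(1,2)] v_bound[OF assms(2)] _ norm_ge_zero] by linarith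
  have "\<bar>w * (p x \<bullet> v t)\<bar> \<le> B * (G * b0 t)"
    unfolding abs_mult using B by (intro mult_mono assms pv) auto
  moreover have "\<bar>w' * ((p x \<bullet> field x t) * (field x t \<bullet> v t))\<bar> \<le> B * ((G * (2 * G)) * (2 * G * b0 t))"
    unfolding abs_mult using B G_nonneg by (intro mult_mono assms pf fv) auto
  ultimately have "\<bar>w * (p x \<bullet> v t) + 2 * (w' * ((p x \<bullet> field x t) * (field x t \<bullet> v t)))\<bar>
      \<le> B * (G * b0 t) + 2 * (B * ((G * (2 * G)) * (2 * G * b0 t)))"
    by linarith
  \<comment> \<open>The 8 collects the factor 2 of the second term and the two field norms bounded
    by \<open>2 * G\<close>.\<close>
  also have "\<dots> = B * (G + 8 * G ^ 3) * b0 t"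
    by (simp add: algebra_simps power3_eq_cube)
  finally have "m * \<bar>w * (p x \<bullet> v t) + 2 * (w' * ((p x \<bullet> field x t) * (field x t \<bullet> v t)))\<bar>
      \<le> m * (B * (G + 8 * G ^ 3) * b0 t)"
    using m by (intro mult_left_mono)
  then show ?thesis
    using m by (simp add: abs_mult mult_ac)
qed

text \<open>The first factor holds the Taylor coefficients at the node times monomials in the
  components of g; the index runs up to \<open>L\<close> because the expansion of \<phi>' is shifted
  by one. The second factor spans p \<bullet> v(t) and (p \<bullet> H)(H \<bullet> v(t)) for every
  \<open>t\<close>. The function p \<bullet> g is a generator since p \<bullet> H = p \<bullet> g -
  p \<bullet> u(t).\<close>

definition taylor_space :: "nat \<Rightarrow> real \<Rightarrow> ('a \<Rightarrow> real) set" where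
  "taylor_space L \<tau> = fun_products
     (\<Union>k<L. fun_products ((\<lambda>i x. \<phi> i (sq x \<tau>)) ` {..L})
        (fun_power (insert (\<lambda>x. 1) (range (\<lambda>i x. g x $ i))) k))
     (fun_products (insert (\<lambda>x. p x \<bullet> g x) (range (\<lambda>i x. p x $ i)))
        (insert (\<lambda>x. 1) (range (\<lambda>i x. g x $ i))))"

lemma finite_taylor_space: "finite (taylor_space L \<tau>)"
  unfolding taylor_space_def by (intro finite_fun_products finite_UN_I finite_fun_power) auto

text \<open>Only the Taylor coefficients depend on the node, and there are at most
  \<open>Suc L\<close> of them at each node.\<close>

lemma card_taylor_space: "\<exists>R. \<forall>\<tau>. card (taylor_space L \<tau>) \<le> R"
proof -
  let ?A = "insert (\<lambda>x. 1) (range (\<lambda>i x. g x $ i))"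
  let ?P = "insert (\<lambda>x. p x \<bullet> g x) (range (\<lambda>i x. p x $ i))"
  let ?D = "\<lambda>\<tau>. (\<lambda>i x. \<phi> i (sq x \<tau>)) ` {..L}"
  have "card (taylor_space L \<tau>) \<le> (\<Sum>k<L. Suc L * card ?A ^ k) * (card ?P * card ?A)" for \<tau>
  proof -
    have D: "card (?D \<tau>) \<le> Suc L"
      using card_image_le[of "{..L}" "\<lambda>i x. \<phi> i (sq x \<tau>)"] by simp
    have "card (fun_products (?D \<tau>) (fun_power ?A k)) \<le> Suc L * card ?A ^ k" for k
      by (rule order_trans[OF card_fun_products_le mult_le_mono[OF D card_fun_power_le]])
         (auto intro!: finite_fun_power)
    then have "(\<Sum>k<L. card (fun_products (?D \<tau>) (fun_power ?A k))) \<le> (\<Sum>k<L. Suc L * card ?A ^ k)"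
      by (intro sum_mono)
    moreover have "card (\<Union>k<L. fun_products (?D \<tau>) (fun_power ?A k))
        \<le> (\<Sum>k<L. card (fun_products (?D \<tau>) (fun_power ?A k)))"
      by (intro card_UN_le) auto
    ultimately have 1: "card (\<Union>k<L. fun_products (?D \<tau>) (fun_power ?A k)) \<le> (\<Sum>k<L. Suc L * card ?A ^ k)"
      by linarith
    have 2: "card (fun_products ?P ?A) \<le> card ?P * card ?A"
      by (intro card_fun_products_le) auto
    have "card (taylor_space L \<tau>)
        \<le> card (\<Union>k<L. fun_products (?D \<tau>) (fun_power ?A k)) * card (fun_products ?P ?A)"
      unfolding taylor_space_def
      by (intro card_fun_products_le finite_fun_products finite_UN_I finite_fun_power) auto
    also have "\<dots> \<le> (\<Sum>k<L. Suc L * card ?A ^ k) * (card ?P * card ?A)"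
      using 1 2 by (rule mult_le_mono)
    finally show ?thesis .
  qed
  then show ?thesis by blast
qed

lemma taylor_space_bounded_measurable:
  assumes "\<tau> \<in> {0<..<T}"
  shows "taylor_space L \<tau> \<subseteq> bounded_measurable M"
proof -
  have A: "insert (\<lambda>x. 1) (range (\<lambda>i x. g x $ i)) \<subseteq> bounded_measurable M"
    using vec_nth_bounded_measurable[OF g_measurable g_bound]
    by (auto intro: bounded_measurableI[where B = 1])
  have "\<bar>p x \<bullet> g x\<bar> \<le> G * G" if "x \<in> space M" for x
    using Cauchy_Schwarz_ineq2[of "p x" "g x"]
      mult_mono[OF p_bound[OF that] g_bound[OF that] G_nonneg norm_ge_zero] by linarith
  then have P: "insert (\<lambda>x. p x \<bullet> g x) (range (\<lambda>i x. p x $ i)) \<subseteq> bounded_measurable M"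
    using vec_nth_bounded_measurable[OF p_measurable p_bound]
    by (auto intro: bounded_measurableI[where B = "G * G"])
  have "(\<lambda>x. \<phi> i (sq x \<tau>)) \<in> bounded_measurable M" for i
  proof -
    obtain B where "\<And>w. w \<in> {0..(2 * G)\<^sup>2} \<Longrightarrow> \<bar>\<phi> i w\<bar> \<le> B"
      using \<phi>_bounded[of i] by blast
    moreover have "(\<lambda>x. \<phi> i (sq x \<tau>)) \<in> borel_measurable M"
    proof -
      note [measurable] = \<phi>_measurable
      have "(\<lambda>x. \<phi> i (max 0 (sq x \<tau>))) \<in> borel_measurable M"
        unfolding sq_def field_def by measurable
      then show ?thesis by (simp add: sq_def)
    qed
    ultimately show ?thesis
      using sq_range[OF _ assms] by (intro bounded_measurableI) auto
  qed
  then show ?thesis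
    unfolding taylor_space_def
    by (intro fun_products_bounded_measurable UN_least fun_power_bounded_measurable A P) auto
qed

lemma taylor_approximation:
  assumes "L > 0"
  obtains E where "E \<ge> 0" "\<And>t \<tau>. t \<in> {0<..<T} \<Longrightarrow> \<tau> \<in> {0<..<T} \<Longrightarrow>
    \<exists>f\<in>lspan (taylor_space L \<tau>). \<forall>x\<in>space M. \<bar>K x t - f x\<bar> \<le> E * sqrt \<bar>t - \<tau>\<bar> ^ L * b0 t"
proof -
  obtain B0 where B0: "B0 \<ge> 0" "\<And>w w'. w \<in> {0..(2 * G)\<^sup>2} \<Longrightarrow> w' \<in> {0..(2 * G)\<^sup>2} \<Longrightarrow>
      \<bar>\<phi> 0 w - (\<Sum>k<L. \<phi> k w' / fact k * (w - w') ^ k)\<bar> \<le> B0 * \<bar>w - w'\<bar> ^ L"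
    by (rule taylor_remainder_bound[where \<phi> = \<phi> and M = L and W = "(2 * G)\<^sup>2"])
       ((rule \<phi>, assumption) | rule assms | blast)+
  \<comment> \<open>The same expansion for the shifted sequence, that is, for \<phi>'.\<close>
  obtain B1 where B1: "B1 \<ge> 0" "\<And>w w'. w \<in> {0..(2 * G)\<^sup>2} \<Longrightarrow> w' \<in> {0..(2 * G)\<^sup>2} \<Longrightarrow>
      \<bar>\<phi> 1 w - (\<Sum>k<L. \<phi> (Suc k) w' / fact k * (w - w') ^ k)\<bar> \<le> B1 * \<bar>w - w'\<bar> ^ L"
    unfolding One_nat_def
    by (rule taylor_remainder_bound[where \<phi> = "\<lambda>k. \<phi> (Suc k)" and M = L and W = "(2 * G)\<^sup>2"])
       ((rule \<phi>, assumption) | rule assms | blast)+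
  define C where "C = m * (G + 8 * G ^ 3)"
  \<comment> \<open>The sum \<open>B0 + B1\<close> serves both remainders, as
    \<open>bilinear_bound\<close> takes a single constant. The absolute value keeps \<open>E\<close>
    nonnegative whatever the sign of \<open>D\<close>.\<close>
  define E where "E = (B0 + B1) * \<bar>4 * G * D\<bar> ^ L * C"
  have C: "C \<ge> 0" using m G_nonneg by (simp add: C_def)
  show ?thesis
  proof (rule that)
    show "E \<ge> 0" using B0 B1 C by (simp add: E_def)
    fix t \<tau> assume t: "t \<in> {0<..<T}" "\<tau> \<in> {0<..<T}"
    let ?A = "insert (\<lambda>x. 1) (range (\<lambda>i x. g x $ i))"
    let ?P = "insert (\<lambda>x. p x \<bullet> g x) (range (\<lambda>i x. p x $ i))"
    let ?D = "(\<lambda>i x. \<phi> i (sq x \<tau>)) ` {..L}"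
    let ?F = "\<Union>k<L. fun_products ?D (fun_power ?A k)"
    \<comment> \<open>The Taylor polynomial of \<phi> for \<open>j = 0\<close> and of \<phi>' for
      \<open>j = 1\<close>.\<close>
    define q where "q = (\<lambda>j x. \<Sum>k<L. \<phi> (k + j) (sq x \<tau>) / fact k * (sq x t - sq x \<tau>) ^ k)"
    define f where "f = (\<lambda>x. - m * (q 0 x * (p x \<bullet> v t)
        + 2 * (q 1 x * ((p x \<bullet> field x t) * (field x t \<bullet> v t)))))"
    have one: "(\<lambda>x. c) \<in> lspan ?A" for c
      using lspan_cmult[OF lspan_base[of "\<lambda>x. 1" ?A], of c] by simp
    have g_inner: "(\<lambda>x. g x \<bullet> y) \<in> lspan ?A" for y
      unfolding inner_vec_def inner_real_def by (intro lspan_sum lspan_cmult' lspan_base) auto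
    have p_inner: "(\<lambda>x. p x \<bullet> y) \<in> lspan ?P" for y
      unfolding inner_vec_def inner_real_def by (intro lspan_sum lspan_cmult' lspan_base) auto
    \<comment> \<open>In the difference of the two squared norms the term g(x) \<bullet> g(x)
      cancels, which leaves an affine function of g(x).\<close>
    have "(\<lambda>x. g x \<bullet> (2 *\<^sub>R (u \<tau> - u t)) + (u t \<bullet> u t - u \<tau> \<bullet> u \<tau>)) \<in> lspan ?A"
      by (intro lspan_add g_inner one)
    moreover have "g x \<bullet> (2 *\<^sub>R (u \<tau> - u t)) + (u t \<bullet> u t - u \<tau> \<bullet> u \<tau>) = sq x t - sq x \<tau>" for x
      by (simp add: sq_def field_def power2_norm_eq_inner algebra_simps inner_commute)
    ultimately have diff: "(\<lambda>x. sq x t - sq x \<tau>) \<in> lspan ?A" by simp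
    have q: "q j \<in> lspan ?F" if "j \<le> 1" for j
      unfolding q_def
    proof (rule lspan_sum)
      fix k assume k: "k \<in> {..<L}"
      have "(\<lambda>x. \<phi> (k + j) (sq x \<tau>)) \<in> lspan ?D"
        using k that by (intro lspan_base) auto
      then have "(\<lambda>x. \<phi> (k + j) (sq x \<tau>) * (1 / fact k) * (sq x t - sq x \<tau>) ^ k)
          \<in> lspan (fun_products ?D (fun_power ?A k))"
        by (intro lspan_mult lspan_cmult' lspan_power diff)
      then show "(\<lambda>x. \<phi> (k + j) (sq x \<tau>) / fact k * (sq x t - sq x \<tau>) ^ k) \<in> lspan ?F"
        using k by (auto elim!: lspan_mono)
    qed
    have pv: "(\<lambda>x. p x \<bullet> v t) \<in> lspan (fun_products ?P ?A)"
      using lspan_mult[OF p_inner[of "v t"] one[of 1]] by simp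
    have "(\<lambda>x. p x \<bullet> g x - p x \<bullet> u t) \<in> lspan ?P"
      by (intro lspan_diff p_inner lspan_base) auto
    then have "(\<lambda>x. p x \<bullet> field x t) \<in> lspan ?P"
      by (simp add: field_def inner_diff_right)
    moreover have "(\<lambda>x. field x t \<bullet> v t) \<in> lspan ?A"
      using lspan_diff[OF g_inner[of "v t"] one[of "u t \<bullet> v t"]] by (simp add: field_def inner_diff_left)
    ultimately have pfv: "(\<lambda>x. (p x \<bullet> field x t) * (field x t \<bullet> v t)) \<in> lspan (fun_products ?P ?A)"
      by (rule lspan_mult)
    have "f \<in> lspan (taylor_space L \<tau>)"
      unfolding f_def taylor_space_def by (intro lspan_cmult lspan_add lspan_mult q pv pfv) auto
    moreover have "\<bar>K x t - f x\<bar> \<le> E * sqrt \<bar>t - \<tau>\<bar> ^ L * b0 t" if x: "x \<in> space M" for x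
    proof -
      note r = sq_range[OF x t(1)] sq_range[OF x t(2)]
      define \<delta> where "\<delta> = \<bar>sq x t - sq x \<tau>\<bar> ^ L"
      have "\<delta> \<ge> 0" by (simp add: \<delta>_def)
      then have "0 \<le> B0 * \<delta>" "0 \<le> B1 * \<delta>" using B0 B1 by simp_all
      moreover have "\<bar>\<phi> 0 (sq x t) - q 0 x\<bar> \<le> B0 * \<delta>" "\<bar>\<phi> 1 (sq x t) - q 1 x\<bar> \<le> B1 * \<delta>"
        using B0(2)[OF r] B1(2)[OF r] by (simp_all add: q_def \<delta>_def)
      ultimately have rem: "\<bar>\<phi> 0 (sq x t) - q 0 x\<bar> \<le> (B0 + B1) * \<delta>"
        "\<bar>\<phi> 1 (sq x t) - q 1 x\<bar> \<le> (B0 + B1) * \<delta>"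
        by (simp_all add: distrib_right)
      have "K x t - f x = - m * ((\<phi> 0 (sq x t) - q 0 x) * (p x \<bullet> v t)
          + 2 * ((\<phi> 1 (sq x t) - q 1 x) * ((p x \<bullet> field x t) * (field x t \<bullet> v t))))"
        by (simp add: K_def f_def algebra_simps)
      also have "\<bar>\<dots>\<bar> \<le> (B0 + B1) * \<delta> * C * b0 t"
        using bilinear_bound[OF x t(1) rem] by (simp add: C_def mult.assoc)
      also have "\<dots> \<le> (B0 + B1) * (\<bar>4 * G * D\<bar> * sqrt \<bar>t - \<tau>\<bar>) ^ L * C * b0 t"
      proof -
        have "\<bar>sq x t - sq x \<tau>\<bar> \<le> \<bar>4 * G * D\<bar> * sqrt \<bar>t - \<tau>\<bar>"
          using sq_holder[OF x t(2,1)]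
          by (rule order_trans) (intro mult_right_mono, auto)
        then have "\<delta> \<le> (\<bar>4 * G * D\<bar> * sqrt \<bar>t - \<tau>\<bar>) ^ L"
          unfolding \<delta>_def by (intro power_mono) auto
        moreover have "0 \<le> b0 t" using v_bound[OF t(1)] norm_ge_zero order_trans by blast
        ultimately show ?thesis
          using B0(1) B1(1) C by (intro mult_right_mono mult_left_mono) auto
      qed
      also have "\<dots> = E * sqrt \<bar>t - \<tau>\<bar> ^ L * b0 t"
        by (simp add: E_def power_mult_distrib mult_ac)
      finally show ?thesis .
    qed
    ultimately show "\<exists>f\<in>lspan (taylor_space L \<tau>). \<forall>x\<in>space M. \<bar>K x t - f x\<bar> \<le> E * sqrt \<bar>t - \<tau>\<bar> ^ L * b0 t"
      by blast
  qed
qed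

end

text \<open>With \<open>R\<close> functions per node, \<open>n\<close> nodes control the entries
  with index beyond \<open>n * R\<close>. Each \<open>N > R'\<close> admits an \<open>n\<close> no
  smaller than \<open>N / (2 * R')\<close>, and since \<open>q \<le> 0\<close>, passing to that
  smaller base only weakens the bound. The finitely many other \<open>N\<close> are covered by
  \<open>Z\<close>. Using \<open>Suc R\<close> keeps the divisor positive.\<close>

lemma powr_rate_from_blocks:
  fixes \<sigma> :: "nat \<Rightarrow> real"
  assumes all: "\<And>N. N \<ge> 1 \<Longrightarrow> \<sigma> N \<le> Z"
    and blocks: "\<And>n N. n \<ge> 1 \<Longrightarrow> n * R < N \<Longrightarrow> \<sigma> N \<le> E * real n powr q"
    and "q \<le> 0" "Z \<ge> 0" "E \<ge> 0"
  shows "\<exists>C. \<forall>N\<ge>1. \<sigma> N \<le> C * real N powr q"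
proof (intro exI allI impI)
  define R' where "R' = Suc R"
  fix N :: nat assume N: "N \<ge> 1"
  let ?r = "real N / (2 * real R')"
  have R': "R' \<ge> 1" and r: "?r > 0" using N by (auto simp: R'_def)
  have "\<sigma> N \<le> (Z + E) * ?r powr q"
  proof (cases "N \<le> R'")
    case True
    then have "?r \<le> 1" using R' by (simp add: divide_simps)
    then have "1 powr q \<le> ?r powr q" using r \<open>q \<le> 0\<close> by (intro powr_mono2') auto
    then have "Z * 1 \<le> (Z + E) * ?r powr q"
      using \<open>Z \<ge> 0\<close> \<open>E \<ge> 0\<close> by (intro mult_mono) auto
    then show ?thesis using all[OF N] by simp
  next
    case False
    define n where "n = (N - 1) div R'"
    have n: "n \<ge> 1" using False R' by (simp add: n_def div_greater_zero_iff Suc_le_eq)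
    have "n * R \<le> n * R'" by (simp add: R'_def)
    also have "\<dots> \<le> N - 1" by (simp add: n_def)
    finally have "n * R < N" using N by linarith
    have "N - 1 < Suc n * R'"
      using R' dividend_less_div_times[of R' "N - 1"] by (simp add: n_def add.commute)
    then have "N \<le> Suc n * R'" by linarith
    also have "\<dots> \<le> 2 * n * R'" using n by (intro mult_right_mono) auto
    finally have "real N \<le> real (2 * n * R')" by (simp only: of_nat_le_iff)
    then have "?r \<le> real n" using R' by (simp add: field_simps)
    then have "real n powr q \<le> ?r powr q" using r \<open>q \<le> 0\<close> by (intro powr_mono2') auto
    then have "E * real n powr q \<le> (Z + E) * ?r powr q"
      using \<open>Z \<ge> 0\<close> \<open>E \<ge> 0\<close> by (intro mult_mono) auto
    then show ?thesis using blocks[OF n \<open>n * R < N\<close>] by linarith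
  qed
  also have "\<dots> = (Z + E) * (1 / (2 * real R')) powr q * real N powr q"
    using N R' by (simp add: powr_divide)
  finally show "\<sigma> N \<le> (Z + E) * (1 / (2 * real (Suc R))) powr q * real N powr q"
    by (simp only: R'_def)
qed

text \<open>The nodes are midpoints of \<open>n\<close> equal cells, so they lie strictly inside the
  interval, where the bounds of \<open>moving_field\<close> hold.\<close>

lemma interval_midpoint_near:
  assumes "0 < t" "t < T" "n \<ge> (1 :: nat)"
  obtains j where "j < n" "\<bar>t - T * (2 * real j + 1) / (2 * real n)\<bar> \<le> T / real n"
proof -
  define j where "j = nat \<lfloor>real n * t / T\<rfloor>"
  have "0 \<le> real n * t / T" using assms by simp
  then have j: "real j \<le> real n * t / T" "real n * t / T < real j + 1"
    by (auto simp: j_def of_nat_nat)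
  have "real n * t / T < real n" using assms by (simp add: field_simps)
  then have "j < n" using j(1) by linarith
  have "\<bar>real n * t / T - (2 * real j + 1) / 2\<bar> \<le> 1" using j by argo
  then have "T / real n * \<bar>real n * t / T - (2 * real j + 1) / 2\<bar> \<le> T / real n * 1"
    using assms by (intro mult_left_mono) auto
  moreover have "T / real n * \<bar>real n * t / T - (2 * real j + 1) / 2\<bar>
      = \<bar>T / real n * (real n * t / T - (2 * real j + 1) / 2)\<bar>"
    using assms by (simp add: abs_mult)
  moreover have "T / real n * (real n * t / T - (2 * real j + 1) / 2)
      = t - T * (2 * real j + 1) / (2 * real n)"
    using assms by (simp add: field_simps)
  ultimately have "\<bar>t - T * (2 * real j + 1) / (2 * real n)\<bar> \<le> T / real n"
    by (simp only: mult_1_right)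
  then show ?thesis using that \<open>j < n\<close> by blast
qed

text \<open>This is completeness of Lebesgue measure. It supplies the measurability of functions
  known only almost everywhere, such as the kernel of the theorem.\<close>

lemma borel_measurable_lebesgue_on_AE:
  fixes f f' :: "'a::euclidean_space \<Rightarrow> real"
  assumes "f \<in> borel_measurable (lebesgue_on S)" "AE x in lebesgue_on S. f' x = f x" "S \<in> sets lebesgue"
  shows "f' \<in> borel_measurable (lebesgue_on S)"
proof -
  have "AE x in lebesgue. x \<in> S \<longrightarrow> f' x = f x"
    using assms(2,3) by (subst (asm) AE_restrict_space_iff) auto
  then have "AE x in lebesgue. (if x \<in> S then f x else 0) = (if x \<in> S then f' x else 0)"
    by eventually_elim auto
  from borel_measurable_AE[OF borel_measurable_if_I[OF assms(1,3)] this] show ?thesis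
    by (rule borel_measurable_if_D)
qed

context moving_field
begin

lemma singular_value_rate:
  assumes F_AE: "\<And>c. c \<in> l2 M \<Longrightarrow> AE t in lebesgue_on {0<..<T}. F c t = integral_operator M K c t"
    and "s \<ge> 1 / 2"
  shows "\<exists>C. \<forall>n\<ge>1. singular_value M (lebesgue_on {0<..<T}) F n \<le> C * real n powr (1 / 2 - s)"
proof -
  let ?N = "lebesgue_on {0<..<T}"
  interpret N: finite_measure ?N
    by (rule finite_measure_lebesgue_on) auto
  obtain B0 where B0: "\<And>w. w \<in> {0..(2 * G)\<^sup>2} \<Longrightarrow> \<bar>\<phi> 0 w\<bar> \<le> B0"
    using \<phi>_bounded[of 0] by blast
  obtain B1 where B1: "\<And>w. w \<in> {0..(2 * G)\<^sup>2} \<Longrightarrow> \<bar>\<phi> 1 w\<bar> \<le> B1"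
    using \<phi>_bounded[of 1] by blast
  have b0_nonneg: "0 \<le> b0 t" if "t \<in> {0<..<T}" for t
    using order_trans[OF norm_ge_zero v_bound[OF that]] .
  \<comment> \<open>The maximum with 1 ensures \<open>b0 t \<le> b t\<close>, so that one function
    \<open>b\<close> dominates both the kernel and the Taylor error.\<close>
  define C0 where "C0 = max 1 (max B0 B1 * (m * (G + 8 * G ^ 3)))"
  define b where "b = (\<lambda>t. C0 * b0 t)"
  have b0_b: "b0 t \<le> b t" if "t \<in> {0<..<T}" for t
    using mult_right_mono[of 1 C0 "b0 t"] b0_nonneg[OF that] by (simp add: b_def C0_def)
  interpret l2_kernel M ?N K b
  proof
    show "(\<lambda>(x, t). K x t) \<in> borel_measurable (M \<Otimes>\<^sub>M ?N)" by (rule K_measurable)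
    show "b \<in> l2 ?N" unfolding b_def by (intro l2_cmult b0)
    fix x t assume x: "x \<in> space M" and "t \<in> space ?N"
    then have t: "t \<in> {0<..<T}" by simp
    have "\<bar>\<phi> 0 (sq x t)\<bar> \<le> max B0 B1" "\<bar>\<phi> 1 (sq x t)\<bar> \<le> max B0 B1"
      using B0 B1 sq_range[OF x t] by fastforce+
    from bilinear_bound[OF x t this]
    have "\<bar>K x t\<bar> \<le> max B0 B1 * (m * (G + 8 * G ^ 3)) * b0 t" by (simp add: K_def)
    also have "\<dots> \<le> b t"
      unfolding b_def by (intro mult_right_mono b0_nonneg t) (simp add: C0_def)
    finally show "\<bar>K x t\<bar> \<le> b t" .
  qed
  have F_measurable: "F c \<in> borel_measurable ?N" if "c \<in> l2 M" for c
    using borel_measurable_lebesgue_on_AE[OF l2_measurable[OF integral_operator_l2[OF that]]]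
      F_AE[OF that] by auto
  define Z where "Z = sqrt ((measure M (space M) + 1) * (LINT t|?N. (b t)\<^sup>2))"
  have Z: "Z \<ge> 0" by (simp add: Z_def)
  have all: "singular_value M ?N F n \<le> Z" if "n \<ge> 1" for n
  proof -
    have "singular_value M ?N F n \<le> 1 * Z"
      unfolding Z_def
    \<comment> \<open>Approximation by zero, with the kernel bound itself as the error, covers every
      index.\<close>
    proof (rule singular_value_le[OF F_AE F_measurable, where S = "{}"])
      show "\<exists>f\<in>lspan {}. \<forall>x\<in>space M. \<bar>K x t - f x\<bar> \<le> 1 * b t" if "t \<in> space ?N" for t
        using K_bound that by (intro bexI[of _ "\<lambda>x. 0"]) (auto intro: lspan.zero)
    qed (use that in auto)
    then show ?thesis by simp
  qed
  define L where "L = nat \<lceil>2 * s\<rceil> + 1"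
  have L: "L > 0" "real L \<ge> 2 * s" unfolding L_def by linarith+
  obtain E where E: "E \<ge> 0" "\<And>t \<tau>. t \<in> {0<..<T} \<Longrightarrow> \<tau> \<in> {0<..<T} \<Longrightarrow>
    \<exists>f\<in>lspan (taylor_space L \<tau>). \<forall>x\<in>space M. \<bar>K x t - f x\<bar> \<le> E * sqrt \<bar>t - \<tau>\<bar> ^ L * b0 t"
    using taylor_approximation[OF L(1)] by blast
  obtain R where R: "\<And>\<tau>. card (taylor_space L \<tau>) \<le> R"
    using card_taylor_space by blast
  have blocks: "singular_value M ?N F k \<le> E * sqrt T ^ L * Z * real n powr (1 / 2 - s)"
    if n: "n \<ge> 1" and k: "n * R < k" for n k
  proof -
    define \<tau> where "\<tau> = (\<lambda>j. T * (2 * real j + 1) / (2 * real n))"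
    have \<tau>: "\<tau> j \<in> {0<..<T}" if "j < n" for j
    proof -
      have "2 * real j + 1 < 2 * real n" using that by linarith
      then have "T * (2 * real j + 1) < T * (2 * real n)" "0 < T * (2 * real j + 1)"
        using T by (simp_all only: mult_less_cancel_left_pos) (intro mult_pos_pos, auto)
      then show ?thesis using n by (simp add: \<tau>_def pos_divide_less_eq)
    qed
    define S where "S = (\<Union>j<n. taylor_space L (\<tau> j))"
    have "card S \<le> (\<Sum>j<n. card (taylor_space L (\<tau> j)))"
      unfolding S_def by (intro card_UN_le) auto
    also have "\<dots> \<le> (\<Sum>j<n. R)" by (intro sum_mono R)
    finally have card: "card S < k" using k by simp
    have "singular_value M ?N F k \<le> (E * sqrt (T / n) ^ L) * Z"
      unfolding Z_def
    proof (rule singular_value_le[OF F_AE F_measurable _ card])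
      show "finite S" unfolding S_def by (intro finite_UN_I finite_taylor_space) auto
      show "a \<in> l2 M" if "a \<in> S" for a
        using that \<tau> taylor_space_bounded_measurable bounded_measurable_l2 unfolding S_def by blast
      show "0 \<le> E * sqrt (T / n) ^ L" using E(1) T by simp
      fix t assume "t \<in> space ?N"
      then have t: "t \<in> {0<..<T}" by simp
      then obtain j where j: "j < n" "\<bar>t - \<tau> j\<bar> \<le> T / n"
        using interval_midpoint_near[of t T n] n unfolding \<tau>_def by auto
      obtain f where f: "f \<in> lspan (taylor_space L (\<tau> j))"
        "\<And>x. x \<in> space M \<Longrightarrow> \<bar>K x t - f x\<bar> \<le> E * sqrt \<bar>t - \<tau> j\<bar> ^ L * b0 t"
        using E(2)[OF t \<tau>[OF j(1)]] by blast
      have "f \<in> lspan S" using f(1) j(1) by (auto simp: S_def elim: lspan_mono)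
      moreover have "E * sqrt \<bar>t - \<tau> j\<bar> ^ L * b0 t \<le> E * sqrt (T / n) ^ L * b t"
        using E(1) j(2) b0_nonneg[OF t] b0_b[OF t] T
        by (intro mult_mono power_mono mult_nonneg_nonneg) auto
      ultimately show "\<exists>f\<in>lspan S. \<forall>x\<in>space M. \<bar>K x t - f x\<bar> \<le> E * sqrt (T / n) ^ L * b t"
        using f(2) by (intro bexI[of _ f]) force+
    qed auto
    also have "\<dots> = E * sqrt T ^ L * Z * sqrt (1 / n) ^ L"
      by (simp add: real_sqrt_divide power_divide)
    also have "sqrt (1 / n) ^ L = real n powr (- real L / 2)"
    proof -
      have "sqrt (1 / n) = real n powr (- 1 / 2)"
        using n by (simp add: real_sqrt_divide powr_minus_divide powr_half_sqrt)
      then show ?thesis using n by (simp add: powr_power)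
    qed
    \<comment> \<open>The choice of \<open>L\<close> gives - L/2 \<le> - s \<le> 1/2 - s, and the
      base is at least 1.\<close>
    also have "E * sqrt T ^ L * Z * real n powr (- real L / 2)
        \<le> E * sqrt T ^ L * Z * real n powr (1 / 2 - s)"
      using E(1) T Z n L(2) by (intro mult_left_mono powr_mono) auto
    finally show ?thesis .
  qed
  show ?thesis
    by (rule powr_rate_from_blocks[OF all blocks])
       (use \<open>s \<ge> 1 / 2\<close> Z E(1) T in auto)
qed

end


section \<open>The operator of the theorem\<close>

text \<open>The set where two continuous functions differ is open, and an open null set is
  empty.\<close>

lemma AE_eq_imp_eq_continuous:
  fixes f f' :: "'a::euclidean_space \<Rightarrow> 'b::metric_space"
  assumes "open S" "continuous_on S f" "continuous_on S f'"
    and "AE x in lebesgue_on S. f x = f' x" "x \<in> S"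
  shows "f x = f' x"
proof (rule ccontr)
  assume "f x \<noteq> f' x"
  define W where "W = S \<inter> (\<lambda>x. dist (f x) (f' x)) -` (- {0})"
  have "open W"
    unfolding W_def using assms by (intro continuous_open_preimage continuous_on_dist) auto
  have "AE x in lebesgue. x \<in> S \<longrightarrow> f x = f' x"
    using assms(1,4) by (subst (asm) AE_restrict_space_iff) auto
  then have "AE x in lebesgue. x \<in> W \<longrightarrow> x \<in> {}"
    by eventually_elim (auto simp: W_def)
  moreover have "x \<in> W"
    using \<open>f x \<noteq> f' x\<close> assms(5) by (simp add: W_def)
  ultimately show False
    using mem_closed_if_AE_lebesgue_open[OF \<open>open W\<close> closed_empty] by blast
qed

text \<open>The pointwise inequality \<bar>w\<bar> \<le> l/2 + w^2/(2 l) is integrated over the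
  interval between \<open>s\<close> and \<open>t\<close>.\<close>

lemma primitive_holder:
  assumes v: "v \<in> l2 (lebesgue_on {0<..<T})"
  shows "\<bar>primitive T v t - primitive T v s\<bar>
    \<le> (1 + (LINT x|lebesgue_on {0<..<T}. (v x)\<^sup>2)) / 2 * sqrt \<bar>t - s\<bar>"
proof -
  let ?N = "lebesgue_on {0<..<T}"
  interpret finite_measure ?N
    by (rule finite_measure_lebesgue_on) auto
  have int: "integrable ?N v" by (rule l2_integrable[OF v])
  define w where "w = (\<lambda>x. if x \<in> {0<..<T} then v x else 0)"
  define e where "e = (LINT x|?N. (v x)\<^sup>2)"
  have *: "\<bar>primitive T v t - primitive T v s\<bar> \<le> (1 + e) / 2 * sqrt (t - s)" if "s < t" for s t
  proof -
    have "integrable lebesgue w"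
      unfolding w_def using int by (subst Lebesgue_Measure.integrable_restrict_UNIV) auto
    then have w: "w integrable_on {s..t}"
      by (metis integrable_on_lebesgue integrable_on_subinterval subset_UNIV interval_cbox)
    have sq: "(\<lambda>x. (w x)\<^sup>2) = (\<lambda>x. if x \<in> {0<..<T} then (v x)\<^sup>2 else 0)"
      by (auto simp: w_def)
    have w2: "(\<lambda>x. (w x)\<^sup>2) integrable_on UNIV" "integral UNIV (\<lambda>x. (w x)\<^sup>2) = e"
      unfolding sq Henstock_Kurzweil_Integration.integrable_restrict_UNIV
        Henstock_Kurzweil_Integration.integral_restrict_UNIV e_def
      using l2_square_integrable[OF v]
      by (auto intro: integrable_on_lebesgue_on lebesgue_integral_eq_integral[symmetric])
    then have w2': "(\<lambda>x. (w x)\<^sup>2) integrable_on {s..t}"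
      by (metis integrable_on_subinterval subset_UNIV interval_cbox)
    have le: "integral {s..t} (\<lambda>x. (w x)\<^sup>2) \<le> e"
      using integral_subset_le[OF _ w2' w2(1)] w2(2) by simp
    \<comment> \<open>This value balances the two terms: both become multiples of
      \<open>sqrt (t - s)\<close>.\<close>
    define l where "l = 1 / sqrt (t - s)"
    have l: "l > 0" using that by (simp add: l_def)
    have w2l: "(\<lambda>x. (w x)\<^sup>2 * (1 / (2 * l))) integrable_on {s..t}"
      by (intro integrable_on_mult_left w2')
    have "\<bar>primitive T v t - primitive T v s\<bar> = norm (integral {s..t} w)"
      using primitive_diff_integral[OF int, of s t] that by (simp add: w_def)
    also have "\<dots> \<le> integral {s..t} (\<lambda>x. l / 2 + (w x)\<^sup>2 * (1 / (2 * l)))"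
    proof (rule Henstock_Kurzweil_Integration.integral_norm_bound_integral[OF w])
      show "(\<lambda>x. l / 2 + (w x)\<^sup>2 * (1 / (2 * l))) integrable_on {s..t}"
        by (intro integrable_add w2l) auto
      fix x
      have "0 \<le> (l - \<bar>w x\<bar>)\<^sup>2" by simp
      then have "2 * l * \<bar>w x\<bar> \<le> l\<^sup>2 + (w x)\<^sup>2" by (simp add: power2_diff)
      then show "norm (w x) \<le> l / 2 + (w x)\<^sup>2 * (1 / (2 * l))"
        using l by (simp add: field_simps power2_eq_square)
    qed
    also have "\<dots> = l / 2 * (t - s) + integral {s..t} (\<lambda>x. (w x)\<^sup>2) * (1 / (2 * l))"
      using that w2l by (subst Henstock_Kurzweil_Integration.integral_add) auto
    also have "\<dots> \<le> l / 2 * (t - s) + e * (1 / (2 * l))"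
      using l le by (intro add_left_mono mult_right_mono) auto
    also have "\<dots> = (1 + e) / 2 * sqrt (t - s)"
    proof -
      have "l * (t - s) = sqrt (t - s)" "1 / l = sqrt (t - s)"
        using that real_div_sqrt[of "t - s"] by (simp_all add: l_def)
      moreover have "l / 2 * (t - s) + e * (1 / (2 * l)) = (l * (t - s) + e * (1 / l)) / 2"
        by (simp add: field_simps)
      ultimately have "l / 2 * (t - s) + e * (1 / (2 * l)) = (sqrt (t - s) + e * sqrt (t - s)) / 2"
        by (simp only:)
      then show ?thesis by (simp add: algebra_simps add_divide_distrib)
    qed
    finally show ?thesis .
  qed
  consider "s < t" | "s = t" | "t < s" by linarith
  then show ?thesis
    using *[of s t] *[of t s] by cases (auto simp: e_def abs_minus_commute)
qed

lemma primitive_continuous: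
  assumes "v \<in> l2 (lebesgue_on {0<..<T})"
  shows "continuous_on S (primitive T v)"
proof (intro continuous_at_imp_continuous_on ballI)
  fix t
  define C where "C = (1 + (LINT x|lebesgue_on {0<..<T}. (v x)\<^sup>2)) / 2"
  have "((\<lambda>s. C * sqrt \<bar>s - t\<bar>) \<longlongrightarrow> C * sqrt \<bar>t - t\<bar>) (at t)"
    by (intro tendsto_intros)
  then have lim: "((\<lambda>s. C * sqrt \<bar>s - t\<bar>) \<longlongrightarrow> 0) (at t)" by simp
  have "((\<lambda>s. primitive T v s - primitive T v t) \<longlongrightarrow> 0) (at t)"
    by (rule Lim_null_comparison[OF _ lim])
       (use primitive_holder[OF assms] in \<open>simp add: C_def always_eventually\<close>)
  then show "isCont (primitive T v) t"
    by (simp add: isCont_def LIM_zero_iff)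
qed

lemma has_vector_derivative_vec_nth:
  fixes f :: "real \<Rightarrow> real ^ 'd"
  assumes "\<And>i. ((\<lambda>t. f t $ i) has_real_derivative f' $ i) (at t)"
  shows "(f has_vector_derivative f') (at t)"
  unfolding has_vector_derivative_def
proof (subst has_derivative_componentwise_within, rule ballI)
  fix b :: "real ^ 'd" assume "b \<in> Basis"
  then obtain i where b: "b = axis i 1" by (auto simp: Basis_vec_def)
  show "((\<lambda>t. f t \<bullet> b) has_derivative (\<lambda>x. (x *\<^sub>R f') \<bullet> b)) (at t)"
    unfolding b inner_axis inner_real_def mult_1_right
    using assms[of i, unfolded has_field_derivative_def]
    by (rule has_derivative_eq_rhs) (simp add: fun_eq_iff)
qed

text \<open>The chain rule passes through the squared norm, so the formula also holds where the
  field vanishes and the norm is not differentiable.\<close>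

lemma langevin_field_derivative:
  fixes u :: "real \<Rightarrow> real ^ 'd"
  assumes \<phi>: "\<And>k w. w \<ge> 0 \<Longrightarrow> (\<phi> k has_field_derivative \<phi> (Suc k) w) (at w)"
    and quotient: "\<And>z. langevin_quotient \<beta> z = \<phi> 0 (z\<^sup>2)"
    and u: "(u has_vector_derivative u') (at t)"
  shows "p \<bullet> vector_derivative (\<lambda>\<tau>. langevin_quotient \<beta> (norm (y - u \<tau>)) *\<^sub>R (y - u \<tau>)) (at t)
    = - (\<phi> 0 ((norm (y - u t))\<^sup>2) * (p \<bullet> u')
        + 2 * (\<phi> 1 ((norm (y - u t))\<^sup>2) * ((p \<bullet> (y - u t)) * ((y - u t) \<bullet> u'))))"
proof -
  let ?f = "y - u t"
  have f: "((\<lambda>\<tau>. y - u \<tau>) has_vector_derivative - u') (at t)"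
    using has_vector_derivative_diff[OF has_vector_derivative_const u] by simp
  have "((\<lambda>\<tau>. (y - u \<tau>) \<bullet> (y - u \<tau>)) has_real_derivative - (2 * (?f \<bullet> u'))) (at t)"
    using has_derivative_inner[OF f[unfolded has_vector_derivative_def] f[unfolded has_vector_derivative_def]]
    unfolding has_field_derivative_def
    by (rule has_derivative_eq_rhs) (simp add: fun_eq_iff inner_commute algebra_simps)
  then have sq: "((\<lambda>\<tau>. (norm (y - u \<tau>))\<^sup>2) has_real_derivative - (2 * (?f \<bullet> u'))) (at t)"
    by (simp add: power2_norm_eq_inner)
  have "((\<lambda>\<tau>. \<phi> 0 ((norm (y - u \<tau>))\<^sup>2)) has_real_derivative \<phi> (Suc 0) ((norm ?f)\<^sup>2) * - (2 * (?f \<bullet> u'))) (at t)"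
    by (rule DERIV_chain2[OF \<phi> sq]) simp
  from has_vector_derivative_scaleR[OF this f]
  have "vector_derivative (\<lambda>\<tau>. \<phi> 0 ((norm (y - u \<tau>))\<^sup>2) *\<^sub>R (y - u \<tau>)) (at t)
    = \<phi> 0 ((norm ?f)\<^sup>2) *\<^sub>R - u' + (\<phi> (Suc 0) ((norm ?f)\<^sup>2) * - (2 * (?f \<bullet> u'))) *\<^sub>R ?f"
    by (rule vector_derivative_at)
  moreover have "p \<bullet> (a *\<^sub>R - u' + (b * - (2 * c)) *\<^sub>R f)
    = - (a * (p \<bullet> u') + 2 * (b * ((p \<bullet> f) * c)))" for a b c f
    by (simp add: inner_add_right inner_diff_right)
  ultimately show ?thesis
    unfolding quotient One_nat_def by (simp only:)
qed

lemma linf_vec_bound: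
  fixes f :: "'a::euclidean_space \<Rightarrow> real ^ 'd"
  assumes "\<And>i. (\<lambda>x. f x $ i) \<in> linf M"
  obtains B where "B \<ge> 0" "AE x in M. norm (f x) \<le> B" "f \<in> borel_measurable M"
proof -
  have "\<forall>i. \<exists>B. AE x in M. \<bar>f x $ i\<bar> \<le> B" using assms by (auto simp: linf_def)
  then obtain B where B: "\<And>i. AE x in M. \<bar>f x $ i\<bar> \<le> B i" by metis
  then have "AE x in M. \<forall>i. \<bar>f x $ i\<bar> \<le> B i" by (simp add: AE_all_countable)
  then have ae: "AE x in M. norm (f x) \<le> (\<Sum>i\<in>UNIV. \<bar>B i\<bar>)"
  proof eventually_elim
    case (elim x)
    have "norm (f x) \<le> (\<Sum>i\<in>UNIV. \<bar>f x $ i\<bar>)" by (rule norm_le_l1_cart)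
    also have "\<dots> \<le> (\<Sum>i\<in>UNIV. \<bar>B i\<bar>)"
    proof (rule sum_mono)
      fix i show "\<bar>f x $ i\<bar> \<le> \<bar>B i\<bar>" using elim[rule_format, of i] by linarith
    qed
    finally show ?case .
  qed
  have "f \<in> borel_measurable M"
    using assms by (subst borel_measurable_euclidean_space) (auto simp: Basis_vec_def inner_axis linf_def)
  then show ?thesis using that[OF _ ae] by (simp add: sum_nonneg)
qed

theorem theorem4p1:
  fixes \<Omega> :: "(real ^ 'd) set"
    and g p :: "real ^ 'd \<Rightarrow> real ^ 'd"
    and h :: "real \<Rightarrow> real ^ 'd"
    and T \<mu>0 m0 \<beta> s :: real
  assumes "CARD('d) \<in> {1, 2, 3}"
    and "bounded_lipschitz_domain \<Omega>"
    and "T > 0" and "\<mu>0 > 0" and "m0 > 0" and "\<beta> > 0"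
    and "s \<ge> 1"
    and "\<And>i. (\<lambda>t. h t $ i) \<in> sobolev s {0<..<T}"
    and "\<And>i. (\<lambda>x. g x $ i) \<in> linf (lebesgue_on \<Omega>)"
    and "\<And>i. (\<lambda>x. p x $ i) \<in> linf (lebesgue_on \<Omega>)"
  shows "\<exists>C. \<forall>n\<ge>1.
    singular_value (lebesgue_on \<Omega>) (lebesgue_on {0<..<T})
      (integral_operator (lebesgue_on \<Omega>) (kernel \<mu>0 m0 \<beta> T g h p)) n
    \<le> C * real n powr (1 / 2 - s)"
proof -
  let ?M = "lebesgue_on \<Omega>" and ?N = "lebesgue_on {0<..<T}"
  have \<Omega>: "\<Omega> \<in> lmeasurable"
    using assms(2) by (auto simp: bounded_lipschitz_domain_def intro: lmeasurable_open)
  interpret M: finite_measure ?M by (rule finite_measure_lebesgue_on[OF \<Omega>])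
  interpret N: finite_measure ?N by (rule finite_measure_lebesgue_on) auto
  obtain \<phi> where \<phi>: "\<And>k w. w \<ge> 0 \<Longrightarrow> (\<phi> k has_field_derivative \<phi> (Suc k) w) (at w)"
    and quotient: "\<And>z. langevin_quotient \<beta> z = \<phi> 0 (z\<^sup>2)"
    by (rule langevin_quotient_smooth[OF assms(6)]) blast
  have "\<forall>i. \<exists>c v. v \<in> l2 ?N \<and> (AE t in ?N. h t $ i = c + primitive T v t)"
  proof
    fix i
    show "\<exists>c v. v \<in> l2 ?N \<and> (AE t in ?N. h t $ i = c + primitive T v t)"
      by (rule sobolev_representation[OF assms(8)[of i] assms(7,3)]) blast
  qed
  then obtain c v where v: "\<And>i. v i \<in> l2 ?N"
    and h: "\<And>i. AE t in ?N. h t $ i = c i + primitive T (v i) t"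
    by metis
  note int = N.l2_integrable[OF v]
  define u' where "u' = (\<lambda>t. \<chi> i. v i t)"
  define u where "u = (\<lambda>t. \<chi> i. c i + primitive T (v i) t)"
  have u_cont: "continuous_on {0<..<T} u"
    unfolding u_def by (intro continuous_on_vec_lambda continuous_intros primitive_continuous v)
  have u_h: "AE t in ?N. u t = h t"
  proof -
    have "AE t in ?N. \<forall>i. h t $ i = c i + primitive T (v i) t"
      using h by (simp add: AE_all_countable)
    then show ?thesis by eventually_elim (simp add: u_def vec_eq_iff)
  qed
  \<comment> \<open>\<open>cont_rep\<close> is an arbitrary choice; \<open>u\<close> shows that a
    continuous version exists, and continuity makes it unique on the open interval.\<close>
  have rep: "cont_rep {0<..<T} h t = u t" if "t \<in> {0<..<T}" for t
  proof -
    let ?r = "cont_rep {0<..<T} h"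
    have r: "continuous_on {0<..<T} ?r \<and> (AE t in ?N. ?r t = h t)"
      unfolding cont_rep_def by (rule someI[of _ u]) (use u_cont u_h in blast)
    then have "AE t in ?N. ?r t = h t" by blast
    with u_h have "AE t in ?N. ?r t = u t" by eventually_elim simp
    then show ?thesis
      using AE_eq_imp_eq_continuous[OF _ _ u_cont _ that] r by auto
  qed
  obtain Bg where Bg: "Bg \<ge> 0" "AE x in ?M. norm (g x) \<le> Bg" "g \<in> borel_measurable ?M"
    by (rule linf_vec_bound[OF assms(9)])
  obtain Bp where Bp: "Bp \<ge> 0" "AE x in ?M. norm (p x) \<le> Bp" "p \<in> borel_measurable ?M"
    by (rule linf_vec_bound[OF assms(10)])
  define Bu where "Bu = (\<Sum>i\<in>UNIV. \<bar>c i\<bar> + (LINT x|?N. \<bar>v i x\<bar>))"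
  have "Bu \<ge> 0" unfolding Bu_def by (intro sum_nonneg add_nonneg_nonneg) auto
  define G where "G = Bg + Bp + Bu"
  have G: "Bg \<le> G" "Bp \<le> G" "Bu \<le> G" "0 \<le> G"
    using Bg(1) Bp(1) \<open>Bu \<ge> 0\<close> by (auto simp: G_def)
  \<comment> \<open>Truncation yields representatives bounded everywhere, as
    \<open>moving_field\<close> requires, that differ from \<open>g\<close> and \<open>p\<close>
    only on null sets.\<close>
  define g' where "g' = (\<lambda>x. if norm (g x) \<le> Bg then g x else 0)"
  define p' where "p' = (\<lambda>x. if norm (p x) \<le> Bp then p x else 0)"
  define D where "D = (\<Sum>i\<in>UNIV. (1 + (LINT x|?N. (v i x)\<^sup>2)) / 2)"
  define b0 where "b0 = (\<lambda>t. \<Sum>i\<in>UNIV. \<bar>v i t\<bar>)"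
  interpret moving_field ?M T G D "\<mu>0 * m0" \<phi> g' p' u u' b0
  proof
    note [measurable] = Bg(3) Bp(3)
    show "g' \<in> borel_measurable ?M" "p' \<in> borel_measurable ?M"
      unfolding g'_def p'_def by measurable
    show "norm (g' x) \<le> G" "norm (p' x) \<le> G" for x
      using G by (auto simp: g'_def p'_def)
    have vec: "f \<in> borel_measurable ?N" if "\<And>i. (\<lambda>t. f t $ i) \<in> borel_measurable ?N" for f :: "real \<Rightarrow> real ^ 'd"
      using that by (subst borel_measurable_euclidean_space) (auto simp: Basis_vec_def inner_axis)
    show "u \<in> borel_measurable ?N"
      using primitive_measurable[OF int] by (intro vec) (simp add: u_def)
    show "u' \<in> borel_measurable ?N"
      using l2_measurable[OF v] by (intro vec) (simp add: u'_def)
    show "norm (u t) \<le> G" for t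
    proof -
      have "norm (u t) \<le> (\<Sum>i\<in>UNIV. \<bar>u t $ i\<bar>)" by (rule norm_le_l1_cart)
      also have "\<dots> \<le> Bu"
        unfolding Bu_def using primitive_bounded[OF int]
        by (intro sum_mono) (auto simp: u_def intro!: order_trans[OF abs_triangle_ineq])
      finally show ?thesis using G by linarith
    qed
    show "norm (u' t) \<le> b0 t" for t
      using norm_le_l1_cart[of "u' t"] by (simp add: u'_def b0_def)
    have "(\<lambda>t. \<bar>v i t\<bar>) \<in> l2 ?N" for i
      using l2_measurable[OF v[of i]] l2_square_integrable[OF v[of i]] by (simp add: l2_def)
    then show "b0 \<in> l2 ?N" unfolding b0_def by (intro l2_sum)
    show "norm (u t - u s) \<le> D * sqrt \<bar>t - s\<bar>" for s t
    proof -
      have "norm (u t - u s) \<le> (\<Sum>i\<in>UNIV. \<bar>(u t - u s) $ i\<bar>)" by (rule norm_le_l1_cart)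
      also have "\<dots> \<le> (\<Sum>i\<in>UNIV. (1 + (LINT x|?N. (v i x)\<^sup>2)) / 2 * sqrt \<bar>t - s\<bar>)"
        using primitive_holder[OF v] by (intro sum_mono) (simp add: u_def)
      finally show ?thesis by (simp add: D_def sum_distrib_right)
    qed
  qed (use \<phi> assms in auto)
  have ae_g: "AE x in ?M. g' x = g x \<and> p' x = p x"
    using Bg(2) Bp(2) by eventually_elim (simp add: g'_def p'_def)
  have "AE t in ?N. \<forall>i. (primitive T (v i) has_real_derivative v i t) (at t)"
    using AE_primitive_deriv[OF int] by (simp add: AE_all_countable)
  \<comment> \<open>One null set of times serves all \<open>x\<close>, because the differentiability
    of \<open>u\<close> at \<open>t\<close> does not involve \<open>x\<close>.\<close>
  then have kernel: "AE t in ?N. \<forall>x. g' x = g x \<and> p' x = p x \<longrightarrow> kernel \<mu>0 m0 \<beta> T g h p x t = K x t"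
  proof (rule lebesgue_on_mono, intro allI impI)
    fix t x assume deriv: "\<forall>i. (primitive T (v i) has_real_derivative v i t) (at t)"
      and t: "t \<in> {0<..<T}" and x: "g' x = g x \<and> p' x = p x"
    have "(u has_vector_derivative u' t) (at t)"
      using deriv
      by (intro has_vector_derivative_vec_nth) (auto simp: u_def u'_def intro!: derivative_eq_intros)
    \<comment> \<open>The values of \<open>cont_rep\<close> off the interval are arbitrary, but a
      derivative at an interior point depends only on a neighbourhood.\<close>
    then have "(cont_rep {0<..<T} h has_vector_derivative u' t) (at t)"
      by (rule has_vector_derivative_transform_within_open[OF _ open_greaterThanLessThan t])
         (simp add: rep)
    from langevin_field_derivative[OF \<phi> quotient this, of "p x" "g x"]
    show "kernel \<mu>0 m0 \<beta> T g h p x t = K x t"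
      using x by (simp add: kernel_def field_H_def K_def sq_def field_def rep[OF t]
        right_diff_distrib distrib_left)
  qed
  show ?thesis
  proof (rule singular_value_rate)
    fix f assume f: "f \<in> l2 ?M"
    show "AE t in ?N. integral_operator ?M (kernel \<mu>0 m0 \<beta> T g h p) f t = integral_operator ?M K f t"
      using kernel
    proof (rule lebesgue_on_mono)
      fix t assume k: "\<forall>x. g' x = g x \<and> p' x = p x \<longrightarrow> kernel \<mu>0 m0 \<beta> T g h p x t = K x t"
        and t: "t \<in> {0<..<T}"
      have ae: "AE x in ?M. f x * kernel \<mu>0 m0 \<beta> T g h p x t = f x * K x t"
        using ae_g by eventually_elim (use k in simp)
      \<comment> \<open>Measurability of the integrand with \<open>kernel\<close> is inherited from
        the one with \<open>K\<close>, since the two agree for almost every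
        \<open>x\<close>.\<close>
      have "(\<lambda>x. K x t) \<in> borel_measurable ?M"
        using measurable_compose[OF measurable_Pair2' K_measurable] t by simp
      then have m: "(\<lambda>x. f x * K x t) \<in> borel_measurable ?M"
        using l2_measurable[OF f] by simp
      show "integral_operator ?M (kernel \<mu>0 m0 \<beta> T g h p) f t = integral_operator ?M K f t"
        unfolding integral_operator_def
        using borel_measurable_lebesgue_on_AE[OF m ae] \<Omega> m ae by (intro integral_cong_AE) auto
    qed
  qed (use assms in simp)
qed

end
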